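(* Let $p$ be an odd prime. There is a one-to-one correspondence, given by $[\tau]_0\mapsto$ the class of the lattice $[1,\tau]$, between the set $\mathfrak{B}_p$ of ramification points of the projection $\pi_\omega:X_0(p)\to\Sigma= X_0(p)/\widetilde{\omega}_p$ and the set $\mathrm{Cl}\,\mathcal{O}_{\mathcal{K}}$ if $p\equiv 1\pmod 4$, respectively the set $\mathrm{Cl}\,\mathcal{O}_{\mathcal{K}}\sqcup\mathrm{Cl}\,\mathcal{O}$ if $p\equiv 3\pmod 4$.
   Context: $X_0(p)$ is the compact modular curve $\Gamma_0(p)\backslash H^*$, where $H$ is the upper half-plane and $H^*=H\cup\mathbb{Q}\cup\{\infty\}$; $[\tau]_0$ denotes the class $\Gamma_0(p)\tau$. The matrix $\omega_p=\begin{pmatrix}0&1\\-p&0\end{pmatrix}$ acts on $H$ by $\tau\mapsto -1/(p\tau)$ and induces an involution $\widetilde{\omega}_p$ of $X_0(p)$. $\mathfrak{B}_p$ is the set of points of $X_0(p)$ fixed by $\widetilde{\omega}_p$, equivalently the set of ramification points of $\pi_\omega$ (these are never cusps, since $\widetilde\omega_p$ exchanges the two cusps $[0]_0$ and $[\infty]_0$). $\mathcal{K}=\mathbb{Q}(\sqrt{-p})\subset\mathbb{C}$, $\mathcal{O}_{\mathcal{K}}=[1,\beta_{-p}]$ is its ring of integers and $\mathcal{O}=[1,2\beta_{-p}]$ its order of conductor $2$, where $[x,y]=\mathbb{Z}x+\mathbb{Z}y$, $\beta_{-p}=\sqrt{-p}$ if $p\equiv 1\pmod 4$ and $\beta_{-p}=\frac{1+\sqrt{-p}}{2}$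 if $p\equiv 3\pmod 4$. For an order $R$ of $\mathcal{K}$, a proper fractional $R$-ideal is a lattice $\mathfrak{a}\subset\mathcal{K}$ with $\{x\in\mathcal{K}: x\mathfrak{a}\subset\mathfrak{a}\}=R$, and $\mathrm{Cl}\,R$ is the group of proper fractional $R$-ideals modulo multiplication by $\mathcal{K}^*$. The union of the two class groups is taken as a disjoint union. *)

theory Defs
  imports "HOL-Analysis.Analysis" "HOL-Computational_Algebra.Primes"
begin

datatype ecomplex = Fin complex | Infty

text \<open>Fractional linear action of an integral matrix of nonzero determinant on the
  Riemann sphere.\<close>

fun mob :: "int^2^2 \<Rightarrow> ecomplex \<Rightarrow> ecomplex" where
  "mob A (Fin z) =
     (if of_int (A$2$1) * z + of_int (A$2$2) = 0 then Infty
      else Fin (moebius (of_int (A$1$1)) (of_int (A$1$2)) (of_int (A$2$1)) (of_int (A$2$2)) z))"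
| "mob A Infty =
     (if A$2$1 = 0 then Infty else Fin (of_int (A$1$1) / of_int (A$2$1)))"

definition Hstar :: "ecomplex set" where
  "Hstar = insert Infty (Fin ` ({\<tau>. Im \<tau> > 0} \<union> \<rat>))"

definition Gamma0 :: "nat \<Rightarrow> (int^2^2) set" where
  "Gamma0 p = {A. det A = 1 \<and> int p dvd A$2$1}"

definition Gamma0_rel :: "nat \<Rightarrow> ecomplex rel" where
  "Gamma0_rel p = {(x, y). x \<in> Hstar \<and> y \<in> Hstar \<and> (\<exists>A\<in>Gamma0 p. y = mob A x)}"

definition X0 :: "nat \<Rightarrow> ecomplex set set" where
  "X0 p = Hstar // Gamma0_rel p"

text \<open>The class \<open>[\<tau>]\<^sub>0\<close> of a point of the upper half-plane.\<close>

definition cls0 :: "nat \<Rightarrow> complex \<Rightarrow> ecomplex set" where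
  "cls0 p \<tau> = Gamma0_rel p `` {Fin \<tau>}"

definition omega :: "nat \<Rightarrow> int^2^2" where
  "omega p = vector [vector [0, 1], vector [- int p, 0]]"

text \<open>The induced map on \<^term>\<open>X0 p\<close>: as \<^term>\<open>omega p\<close> normalises \<^term>\<open>Gamma0 p\<close>, the image
  of a class is again a class (see \<open>fricke_class\<close> below).\<close>

definition fricke :: "nat \<Rightarrow> ecomplex set \<Rightarrow> ecomplex set" where
  "fricke p P = mob (omega p) ` P"

definition fricke_rel :: "nat \<Rightarrow> ecomplex set rel" where
  "fricke_rel p = {(P, Q). P \<in> X0 p \<and> Q \<in> X0 p \<and> (Q = P \<or> Q = fricke p P)}"

definition Sigma_curve :: "nat \<Rightarrow> ecomplex set set set" where
  "Sigma_curve p = X0 p // fricke_rel p"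

definition pi_omega :: "nat \<Rightarrow> ecomplex set \<Rightarrow> ecomplex set set" where
  "pi_omega p P = fricke_rel p `` {P}"

text \<open>The set \<open>\<BB>\<^sub>p\<close>, defined by fixed points; by \<open>ramification_points_fibre\<close> below, these are
  the points at which the two points of a generic fibre of \<^term>\<open>pi_omega p\<close> coalesce.\<close>

definition ramification_points :: "nat \<Rightarrow> ecomplex set set" where
  "ramification_points p = {P \<in> X0 p. fricke p P = P}"

text \<open>\<open>[x, y] = \<int>x + \<int>y\<close>\<close>

definition zspan2 :: "complex \<Rightarrow> complex \<Rightarrow> complex set" where
  "zspan2 x y = {of_int m * x + of_int n * y | m n. True}"

definition sqrt_neg :: "nat \<Rightarrow> complex" where
  "sqrt_neg p = \<i> * of_real (sqrt (real p))"

definition quad_field :: "nat \<Rightarrow> complex set" where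
  "quad_field p = {of_rat a + of_rat b * sqrt_neg p | a b. True}"

definition beta :: "nat \<Rightarrow> complex" where
  "beta p = (if p mod 4 = 1 then sqrt_neg p else (1 + sqrt_neg p) / 2)"

definition max_order :: "nat \<Rightarrow> complex set" where
  "max_order p = zspan2 1 (beta p)"

definition order2 :: "nat \<Rightarrow> complex set" where
  "order2 p = zspan2 1 (2 * beta p)"

definition is_lattice :: "complex set \<Rightarrow> bool" where
  "is_lattice L \<longleftrightarrow> (\<exists>x y. y \<noteq> 0 \<and> x / y \<notin> \<real> \<and> L = zspan2 x y)"

definition multiplier_ring :: "nat \<Rightarrow> complex set \<Rightarrow> complex set" where
  "multiplier_ring p L = {x \<in> quad_field p. (*) x ` L \<subseteq> L}"

definition proper_ideals :: "nat \<Rightarrow> complex set \<Rightarrow> complex set set" where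
  "proper_ideals p R = {L. is_lattice L \<and> L \<subseteq> quad_field p \<and> multiplier_ring p L = R}"

definition homothety_rel :: "nat \<Rightarrow> complex set \<Rightarrow> complex set rel" where
  "homothety_rel p R = {(L, M). L \<in> proper_ideals p R \<and> M \<in> proper_ideals p R \<and>
     (\<exists>c \<in> quad_field p - {0}. M = (*) c ` L)}"

text \<open>The underlying set of the class group.\<close>

definition Cl :: "nat \<Rightarrow> complex set \<Rightarrow> complex set set set" where
  "Cl p R = proper_ideals p R // homothety_rel p R"

definition ideal_class :: "nat \<Rightarrow> complex set \<Rightarrow> complex set \<Rightarrow> complex set set" where
  "ideal_class p R L = homothety_rel p R `` {L}"

lemma moebius_compose:
  fixes a b c d a' b' c' d' z :: complex
  assumes "a' * d' - b' * c' \<noteq> 0" "c' * z + d' \<noteq> 0"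
  shows "c * moebius a' b' c' d' z + d =
           ((c * a' + d * c') * z + (c * b' + d * d')) / (c' * z + d')"
    and "a * moebius a' b' c' d' z + b =
           ((a * a' + b * c') * z + (a * b' + b * d')) / (c' * z + d')"
  using assms by (auto simp: moebius_def field_simps)

lemma mob_mult:
  assumes "det A \<noteq> 0" "det B \<noteq> 0"
  shows "mob (A ** B) x = mob A (mob B x)"
proof -
  define a b c d where abcd: "a = (of_int (A$1$1) :: complex)" "b = (of_int (A$1$2) :: complex)"
    "c = (of_int (A$2$1) :: complex)" "d = (of_int (A$2$2) :: complex)"
  define a' b' c' d' where abcd': "a' = (of_int (B$1$1) :: complex)" "b' = (of_int (B$1$2) :: complex)"
    "c' = (of_int (B$2$1) :: complex)" "d' = (of_int (B$2$2) :: complex)"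
  have "of_int (det A) \<noteq> (0::complex)" "of_int (det B) \<noteq> (0::complex)"
    using assms by simp_all
  hence dA: "a * d - b * c \<noteq> 0" and dB: "a' * d' - b' * c' \<noteq> 0"
    by (simp_all add: det_2 abcd abcd')
  have AB: "of_int ((A**B)$1$1) = a * a' + b * c'" "of_int ((A**B)$1$2) = a * b' + b * d'"
    "of_int ((A**B)$2$1) = c * a' + d * c'" "of_int ((A**B)$2$2) = c * b' + d * d'"
    by (simp_all add: matrix_matrix_mult_def sum_2 abcd abcd')
  have nz: "A$2$1 = 0 \<longleftrightarrow> c = 0" "B$2$1 = 0 \<longleftrightarrow> c' = 0"
      "(A**B)$2$1 = 0 \<longleftrightarrow> c * a' + d * c' = 0"
    using AB(3) by (simp_all add: abcd abcd') (metis of_int_eq_0_iff)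
  show ?thesis
  proof (cases x)
    case Infty
    show ?thesis
    proof (cases "c' = 0")
      case True
      hence "a' \<noteq> 0" using dB by auto
      thus ?thesis using True nz AB(1,3) by (simp add: Infty flip: abcd)
    next
      case False
      thus ?thesis using nz AB(1,3)
        by (auto simp: Infty moebius_def divide_simps simp flip: abcd abcd')
    qed
  next
    case (Fin z)
    show ?thesis
    proof (cases "c' * z + d' = 0")
      case True
      have "d' = - c' * z" using True by (simp add: add_eq_0_iff)
      hence c': "c' \<noteq> 0" using dB by auto
      have n: "a' * z + b' \<noteq> 0"
      proof
        assume "a' * z + b' = 0"
        hence "b' = - a' * z" by (simp add: add_eq_0_iff)
        with \<open>d' = - c' * z\<close> dB show False by simp
      qed
      have e: "(c * a' + d * c') * z + (c * b' + d * d') = c * (a' * z + b')"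
              "(a * a' + b * c') * z + (a * b' + b * d') = a * (a' * z + b')"
        using \<open>d' = - c' * z\<close> by (simp_all add: algebra_simps)
      have m: "mob B x = Infty"
        using True by (simp add: Fin flip: abcd')
      show ?thesis
        unfolding m unfolding Fin
        using n by (simp add: AB moebius_def e nz(1) flip: abcd)
    next
      case False
      define w where "w = moebius a' b' c' d' z"
      have m: "mob B x = Fin w"
        using False by (simp add: Fin w_def flip: abcd')
      note w = moebius_compose[OF dB False, of c d, folded w_def]
        moebius_compose[OF dB False, of a b, folded w_def]
      show ?thesis
        unfolding m unfolding Fin
        using False w(1,4) by (simp add: AB moebius_def flip: abcd)
    qed
  qed
qed

lemma mob_one: "mob (mat 1) x = x"
  by (cases x) (auto simp: mat_def moebius_def)

lemma det_omega: "det (omega p) = int p"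
  by (simp add: det_2 omega_def)

lemma Im_moebius_pos:
  fixes a b c d :: int
  assumes "a * d - b * c > 0" "Im z > 0"
  shows "Im (moebius (of_int a) (of_int b) (of_int c) (of_int d) z) > 0"
proof -
  have n: "of_int c * z + of_int d \<noteq> 0"
  proof
    assume h: "of_int c * z + of_int d = 0"
    hence "Im (of_int c * z + of_int d) = 0" by simp
    hence "c = 0" using assms(2) by simp
    with h have "d = 0" by simp
    with \<open>c = 0\<close> assms(1) show False by simp
  qed
  have "real_of_int (a * d - b * c) > 0" using assms(1) by linarith
  hence p: "(a * d - b * c) * Im z > 0" using assms(2) by simp
  have "(cmod (of_int c * z + of_int d))\<^sup>2 > 0" using n by simp
  moreover have "Im (moebius (of_int a) (of_int b) (of_int c) (of_int d) z) =
      (a * d - b * c) * Im z / (cmod (of_int c * z + of_int d))\<^sup>2"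
    unfolding moebius_def Im_divide cmod_power2 by (simp add: algebra_simps)
  ultimately show ?thesis using p by simp
qed

lemma mob_Hstar:
  assumes "det A > 0" "x \<in> Hstar"
  shows "mob A x \<in> Hstar"
proof (cases x)
  case Infty
  thus ?thesis by (auto simp: Hstar_def)
next
  case (Fin z)
  hence "Im z > 0 \<or> z \<in> \<rat>" using assms(2) by (auto simp: Hstar_def)
  hence "Im (moebius (of_int (A$1$1)) (of_int (A$1$2)) (of_int (A$2$1)) (of_int (A$2$2)) z) > 0 \<or>
         moebius (of_int (A$1$1)) (of_int (A$1$2)) (of_int (A$2$1)) (of_int (A$2$2)) z \<in> \<rat>"
    using Im_moebius_pos[of "A$1$1" "A$2$2" "A$1$2" "A$2$1" z] assms(1)
    by (auto simp: det_2 moebius_def)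
  thus ?thesis by (auto simp: Fin Hstar_def)
qed

lemma Gamma0_mult: "A \<in> Gamma0 p \<Longrightarrow> B \<in> Gamma0 p \<Longrightarrow> A ** B \<in> Gamma0 p"
  unfolding Gamma0_def by (simp add: det_mul) (simp add: matrix_matrix_mult_def sum_2)

lemma mat2_eqI:
  "A$1$1 = B$1$1 \<Longrightarrow> A$1$2 = B$1$2 \<Longrightarrow> A$2$1 = B$2$1 \<Longrightarrow> A$2$2 = B$2$2 \<Longrightarrow> A = (B :: 'a^2^2)"
  by (simp add: vec_eq_iff forall_2)

lemma Gamma0_inverse:
  assumes "A \<in> Gamma0 p"
  obtains B where "B \<in> Gamma0 p" "B ** A = mat 1"
proof
  define B :: "int^2^2" where
    "B = vector [vector [A$2$2, - A$1$2], vector [- A$2$1, A$1$1]]"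
  show "B \<in> Gamma0 p" using assms by (auto simp: Gamma0_def det_2 B_def algebra_simps)
  show "B ** A = mat 1" using assms
    by (intro mat2_eqI)
       (auto simp: Gamma0_def det_2 B_def algebra_simps mat_def matrix_matrix_mult_def sum_2)
qed

lemma equiv_Gamma0_rel: "equiv Hstar (Gamma0_rel p)"
proof (rule equivI)
  show "Gamma0_rel p \<subseteq> Hstar \<times> Hstar" by (auto simp: Gamma0_rel_def)
  have "(mat 1 :: int^2^2) \<in> Gamma0 p" by (simp add: Gamma0_def mat_def det_2)
  thus "refl_on Hstar (Gamma0_rel p)"
    using mob_one by (auto simp: Gamma0_rel_def refl_on_def intro!: bexI[of _ "mat 1"])
  show "sym (Gamma0_rel p)"
  proof (rule symI)
    fix x y assume "(x, y) \<in> Gamma0_rel p"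
    then obtain A where A: "x \<in> Hstar" "y \<in> Hstar" "A \<in> Gamma0 p" "y = mob A x"
      by (auto simp: Gamma0_rel_def)
    then obtain B where B: "B \<in> Gamma0 p" "B ** A = mat 1" using Gamma0_inverse by blast
    have "mob B y = x"
      using A B mob_mult[of B A x] by (auto simp: Gamma0_def mob_one)
    thus "(y, x) \<in> Gamma0_rel p" using A(1,2) B(1) by (force simp: Gamma0_rel_def)
  qed
  show "trans (Gamma0_rel p)"
  proof (rule transI)
    fix x y z assume "(x, y) \<in> Gamma0_rel p" "(y, z) \<in> Gamma0_rel p"
    then obtain A B where A: "x \<in> Hstar" "z \<in> Hstar" "A \<in> Gamma0 p" "B \<in> Gamma0 p"
      "y = mob A x" "z = mob B y"
      by (auto simp: Gamma0_rel_def)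
    have "mob (B ** A) x = z" using A by (auto simp: Gamma0_def mob_mult)
    thus "(x, z) \<in> Gamma0_rel p" using A(1,2) Gamma0_mult[OF A(4,3)] by (force simp: Gamma0_rel_def)
  qed
qed

lemma Gamma0_normalised:
  assumes "A \<in> Gamma0 p"
  obtains B where "B \<in> Gamma0 p" "omega p ** A = B ** omega p"
proof -
  from assms obtain k where k: "A$2$1 = int p * k" "det A = 1" by (auto simp: Gamma0_def)
  show ?thesis
  proof
    define B :: "int^2^2" where
      "B = vector [vector [A$2$2, - k], vector [- int p * A$1$2, A$1$1]]"
    show "B \<in> Gamma0 p" using k by (auto simp: Gamma0_def det_2 B_def algebra_simps)
    show "omega p ** A = B ** omega p" using k
      by (intro mat2_eqI) (auto simp: omega_def B_def matrix_matrix_mult_def sum_2)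
  qed
qed

lemma mob_omega_omega:
  assumes "p > 0"
  shows "mob (omega p) (mob (omega p) x) = x"
  using assms by (cases x) (auto simp: omega_def moebius_def)

lemma mob_omega_Hstar: "p > 0 \<Longrightarrow> x \<in> Hstar \<Longrightarrow> mob (omega p) x \<in> Hstar"
  by (rule mob_Hstar) (simp_all add: det_omega)

lemma mob_omega_rel:
  assumes "p > 0" "(x, y) \<in> Gamma0_rel p"
  shows "(mob (omega p) x, mob (omega p) y) \<in> Gamma0_rel p"
proof -
  from assms(2) obtain A where A: "x \<in> Hstar" "y \<in> Hstar" "A \<in> Gamma0 p" "y = mob A x"
    by (auto simp: Gamma0_rel_def)
  then obtain B where B: "B \<in> Gamma0 p" "omega p ** A = B ** omega p"
    using Gamma0_normalised by blast
  have "mob (omega p) y = mob (omega p ** A) x"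
    using A assms by (auto simp: Gamma0_def mob_mult det_omega)
  also have "\<dots> = mob B (mob (omega p) x)"
    unfolding B(2) using B assms by (auto simp: Gamma0_def mob_mult det_omega)
  finally show ?thesis
    using mob_omega_Hstar[OF assms(1) A(1)] mob_omega_Hstar[OF assms(1) A(2)] B(1)
    by (auto simp: Gamma0_rel_def)
qed

lemma fricke_class:
  assumes "p > 0"
  shows "fricke p (Gamma0_rel p `` {x}) = Gamma0_rel p `` {mob (omega p) x}"
proof (intro set_eqI iffI)
  fix y assume "y \<in> Gamma0_rel p `` {mob (omega p) x}"
  hence "(x, mob (omega p) y) \<in> Gamma0_rel p"
    using mob_omega_rel[OF assms, of "mob (omega p) x" y] assms by (simp add: mob_omega_omega)
  thus "y \<in> fricke p (Gamma0_rel p `` {x})"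
    using assms
    by (auto simp: fricke_def image_iff mob_omega_omega intro!: bexI[of _ "mob (omega p) y"])
qed (use mob_omega_rel[OF assms] in \<open>auto simp: fricke_def\<close>)

lemma fricke_X0: "p > 0 \<Longrightarrow> P \<in> X0 p \<Longrightarrow> fricke p P \<in> X0 p"
  by (auto simp: X0_def fricke_class elim!: quotientE intro!: quotientI mob_omega_Hstar)

lemma fricke_fricke: "p > 0 \<Longrightarrow> fricke p (fricke p P) = P"
  by (simp add: fricke_def image_image mob_omega_omega)

lemma ramification_points_fibre:
  assumes "p > 0"
  shows "ramification_points p = {P \<in> X0 p. {Q \<in> X0 p. pi_omega p Q = pi_omega p P} = {P}}"
proof -
  have eq: "pi_omega p Q = {Q, fricke p Q}" if "Q \<in> X0 p" for Q
    using that assms fricke_X0 by (auto simp: pi_omega_def fricke_rel_def)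
  have fib: "{Q \<in> X0 p. pi_omega p Q = pi_omega p P} = {P, fricke p P}" if "P \<in> X0 p" for P
  proof -
    have "pi_omega p (fricke p P) = pi_omega p P"
      using that assms by (simp add: eq fricke_X0 fricke_fricke insert_commute)
    thus ?thesis using that eq fricke_X0[OF assms that] by (auto simp: doubleton_eq_iff)
  qed
  have "fricke p P = P \<longleftrightarrow> {Q \<in> X0 p. pi_omega p Q = pi_omega p P} = {P}" if "P \<in> X0 p" for P
    unfolding fib[OF that] by auto
  thus ?thesis unfolding ramification_points_def by blast
qed

end

theory Submission
  imports Defs
begin

text \<open>
  Write \<open>s = sqrt(-p)\<close> and \<open>L = [1, \<tau>]\<close>. A point of \<open>X\<^sub>0(p)\<close> records a lattice together with a
  sublattice of index \<open>p\<close>; the class of \<open>\<tau>\<close> stands for the pair \<open>[1, p\<tau>] \<subseteq> L\<close>, and the Fricke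
  involution sends it to \<open>pL \<subseteq> [1, p\<tau>]\<close>. A class is therefore fixed iff some complex number
  carries \<open>L\<close> to \<open>[1, p\<tau>]\<close> and \<open>[1, p\<tau>]\<close> to \<open>pL\<close>; this number can be taken to be \<open>s\<close>. So the
  ramification points are the lattices stable under multiplication by \<open>s\<close>, and the sublattice
  is then no further datum, being \<open>sL\<close>. This is why \<open>[\<tau>]\<^sub>0 \<mapsto> [1, \<tau>]\<close> is injective up to homothety,
  and every lattice in \<open>\<K>\<close> with multiplication by \<open>s\<close> occurs. The orders of \<open>\<K>\<close> that contain
  \<open>s\<close> are \<open>\<int>[s]\<close> and, if \<open>p \<equiv> 3\<close> modulo \<open>4\<close>, also the ring \<open>[1, (1 + s)/2]\<close> around it.

  In coordinates, the matrices \<open>M = \<omega>\<^sub>p A\<close> with \<open>A \<in> \<Gamma>\<^sub>0(p)\<close> have determinant \<open>p\<close> and trace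
  \<open>p t\<close>, so the fixed-point equation of \<open>M\<close> has discriminant
  \<open>p\<^sup>2 t\<^sup>2 - 4p\<close>. This is never a rational square, which excludes the cusps
  (\<open>no_rational_fixed_point\<close>), and it is negative only for \<open>t = 0\<close>, or for \<open>p = 3\<close> and
  \<open>t = \<plusminus>1\<close>. In either case \<open>p c \<tau> = p a + s\<close> for integers with \<open>b c = p a\<^sup>2 + 1\<close>
  (\<open>omega_fixed_imp_fricke_point\<close>), that is, \<open>\<tau>\<close> is a root of the form \<open>[p c, -2 p a, b]\<close> of
  discriminant \<open>-4p\<close>. Injectivity is \<open>homothetic_imp_cls0_eq\<close>, surjectivity is
  \<open>stable_lattice_homothetic_fricke_point\<close>, and the order attached to \<open>\<tau>\<close> depends only on
  whether that form is primitive (\<open>multiplier_ring_primitive\<close>,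
  \<open>multiplier_ring_imprimitive\<close>).
\<close>

section \<open>Lattices in the imaginary quadratic field\<close>

lemma sqrt_neg_mult_self: "sqrt_neg p * sqrt_neg p = - of_nat p"
  by (simp add: sqrt_neg_def complex_eq_iff)

lemma Im_sqrt_neg: "Im (sqrt_neg p) = sqrt (real p)"
  by (simp add: sqrt_neg_def)

lemma quad_fieldI: "of_rat a + of_rat b * sqrt_neg p \<in> quad_field p"
  by (auto simp: quad_field_def)

lemma quad_field_of_int: "of_int m \<in> quad_field p"
  using quad_fieldI[of "of_int m" 0 p] by simp

lemma quad_field_sqrt_neg: "sqrt_neg p \<in> quad_field p"
  using quad_fieldI[of 0 1 p] by simp

lemma quad_field_add:
  assumes "x \<in> quad_field p" "y \<in> quad_field p"
  shows "x + y \<in> quad_field p"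
proof -
  from assms obtain a b c d where "x = of_rat a + of_rat b * sqrt_neg p"
    "y = of_rat c + of_rat d * sqrt_neg p" by (auto simp: quad_field_def)
  hence "x + y = of_rat (a + c) + of_rat (b + d) * sqrt_neg p"
    by (simp add: of_rat_add algebra_simps)
  thus ?thesis using quad_fieldI by simp
qed

lemma quad_field_mult:
  assumes "x \<in> quad_field p" "y \<in> quad_field p"
  shows "x * y \<in> quad_field p"
proof -
  from assms obtain a b c d where x: "x = of_rat a + of_rat b * sqrt_neg p"
    and y: "y = of_rat c + of_rat d * sqrt_neg p" by (auto simp: quad_field_def)
  have "x * y = of_rat a * of_rat c + of_rat b * of_rat d * (sqrt_neg p * sqrt_neg p)
      + (of_rat a * of_rat d + of_rat b * of_rat c) * sqrt_neg p"
    by (simp add: x y algebra_simps)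
  also have "\<dots> = of_rat (a * c - of_nat p * b * d) + of_rat (a * d + b * c) * sqrt_neg p"
    by (simp add: sqrt_neg_mult_self of_rat_add of_rat_mult of_rat_diff)
  finally show ?thesis using quad_fieldI by simp
qed

lemma quad_field_inverse:
  assumes "x \<in> quad_field p"
  shows "inverse x \<in> quad_field p"
proof (cases "x = 0")
  case False
  from assms obtain a b where x: "x = of_rat a + of_rat b * sqrt_neg p"
    by (auto simp: quad_field_def)
  define y where "y = of_rat a - of_rat b * sqrt_neg p"
  define N where "N = a * a + of_nat p * b * b"
  have y: "y \<in> quad_field p"
    using quad_fieldI[of a "- b" p] by (simp add: y_def of_rat_minus)
  have "x * y = of_rat a * of_rat a - of_rat b * of_rat b * (sqrt_neg p * sqrt_neg p)"
    by (simp add: x y_def algebra_simps)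
  hence xy: "x * y = of_rat N"
    by (simp add: sqrt_neg_mult_self of_rat_add of_rat_mult N_def)
  have "N \<noteq> 0"
  proof
    assume N: "N = 0"
    have "a * a \<ge> 0" "of_nat p * b * b \<ge> 0" by (simp_all add: mult.assoc)
    with N have "a * a = 0" "of_nat p * b * b = 0" unfolding N_def by linarith+
    hence "x = 0" by (auto simp: x sqrt_neg_def)
    with False show False by simp
  qed
  hence "inverse x = of_rat (1 / N) * y"
    using xy False by (simp add: of_rat_divide field_simps)
  thus ?thesis using quad_field_mult[OF _ y, of "of_rat (1 / N)"] quad_fieldI[of "1/N" 0 p] by simp
qed (use quad_field_of_int[of 0 p] in simp)

lemma zspan2I: "of_int m * x + of_int n * y \<in> zspan2 x y"
  by (auto simp: zspan2_def)

lemma zspan2_gens: "x \<in> zspan2 x y" "y \<in> zspan2 x y"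
  using zspan2I[of 1 x 0 y] zspan2I[of 0 x 1 y] by simp_all

lemma zspan2_add: "u \<in> zspan2 x y \<Longrightarrow> v \<in> zspan2 x y \<Longrightarrow> u + v \<in> zspan2 x y"
proof -
  assume "u \<in> zspan2 x y" "v \<in> zspan2 x y"
  then obtain a b c d where "u = of_int a * x + of_int b * y" "v = of_int c * x + of_int d * y"
    by (auto simp: zspan2_def)
  hence "u + v = of_int (a + c) * x + of_int (b + d) * y" by (simp add: algebra_simps)
  thus ?thesis using zspan2I by metis
qed

lemma zspan2_of_int_mult: "u \<in> zspan2 x y \<Longrightarrow> of_int k * u \<in> zspan2 x y"
proof -
  assume "u \<in> zspan2 x y"
  then obtain a b where "u = of_int a * x + of_int b * y" by (auto simp: zspan2_def)
  hence "of_int k * u = of_int (k * a) * x + of_int (k * b) * y" by (simp add: algebra_simps)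
  thus ?thesis using zspan2I by metis
qed

lemma zspan2_subset: "u \<in> zspan2 x y \<Longrightarrow> v \<in> zspan2 x y \<Longrightarrow> zspan2 u v \<subseteq> zspan2 x y"
  by (auto simp: zspan2_def[of u v] intro!: zspan2_add zspan2_of_int_mult)

lemma zspan2_scale: "(*) c ` zspan2 x y = zspan2 (c * x) (c * y)"
proof -
  have "c * (of_int m * x + of_int n * y) = of_int m * (c * x) + of_int n * (c * y)" for m n
    by (simp add: algebra_simps)
  thus ?thesis by (force simp: zspan2_def image_iff)
qed

lemma zspan2_shift: "zspan2 1 (of_int j + u) = zspan2 1 u"
proof
  have "of_int j + u \<in> zspan2 1 u" using zspan2I[of j 1 1 u] by simp
  thus "zspan2 1 (of_int j + u) \<subseteq> zspan2 1 u" by (intro zspan2_subset zspan2_gens)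
  have "u \<in> zspan2 1 (of_int j + u)" using zspan2I[of "-j" 1 1 "of_int j + u"] by simp
  thus "zspan2 1 u \<subseteq> zspan2 1 (of_int j + u)" by (intro zspan2_subset zspan2_gens)
qed

lemma zspan2_quad_field: "x \<in> quad_field p \<Longrightarrow> y \<in> quad_field p \<Longrightarrow> zspan2 x y \<subseteq> quad_field p"
  by (auto simp: zspan2_def intro!: quad_field_add quad_field_mult quad_field_of_int)

lemma zspan2_coeffs_unique:
  assumes "Im \<tau> \<noteq> 0" "of_int m + of_int n * \<tau> = of_int m' + of_int n' * \<tau>"
  shows "m = m'" "n = n'"
proof -
  have "Im (of_int m + of_int n * \<tau>) = Im (of_int m' + of_int n' * \<tau>)" using assms(2) by simp
  thus n: "n = n'" using assms(1) by simp
  show "m = m'" using assms(2) n by simp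
qed

lemma proper_ideals_homothety:
  assumes "L \<in> proper_ideals p R" "c \<in> quad_field p - {0}"
  shows "(*) c ` L \<in> proper_ideals p R"
proof -
  from assms have c: "c \<in> quad_field p" "c \<noteq> 0" by auto
  from assms obtain x y where xy: "y \<noteq> 0" "x / y \<notin> \<real>" "L = zspan2 x y"
    by (auto simp: proper_ideals_def is_lattice_def)
  have "is_lattice ((*) c ` L)"
    unfolding is_lattice_def xy(3) zspan2_scale
    using xy(1,2) c by (intro exI[of _ "c * x"] exI[of _ "c * y"]) auto
  moreover have "(*) c ` L \<subseteq> quad_field p"
    using assms c by (auto simp: proper_ideals_def intro!: quad_field_mult)
  moreover have "(*) x ` (*) c ` L \<subseteq> (*) c ` L \<longleftrightarrow> (*) x ` L \<subseteq> L" for x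
  proof -
    have "(*) x ` (*) c ` L = (*) c ` (*) x ` L" by (simp add: image_image mult.left_commute)
    moreover have "inj ((*) c)" using c by (auto intro: injI)
    ultimately show ?thesis by (simp add: inj_image_subset_iff)
  qed
  hence "multiplier_ring p ((*) c ` L) = multiplier_ring p L" by (simp add: multiplier_ring_def)
  ultimately show ?thesis using assms by (simp add: proper_ideals_def)
qed

lemma equiv_homothety_rel: "equiv (proper_ideals p R) (homothety_rel p R)"
proof (rule equivI)
  show "homothety_rel p R \<subseteq> proper_ideals p R \<times> proper_ideals p R"
    by (auto simp: homothety_rel_def)
  have "(1::complex) \<in> quad_field p - {0}" using quad_field_of_int[of 1 p] by simp
  moreover have "L = (*) 1 ` L" for L :: "complex set" by simp
  ultimately show "refl_on (proper_ideals p R) (homothety_rel p R)"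
    unfolding refl_on_def homothety_rel_def by blast
  show "sym (homothety_rel p R)"
  proof (rule symI)
    fix L M assume "(L, M) \<in> homothety_rel p R"
    then obtain c where c: "L \<in> proper_ideals p R" "M \<in> proper_ideals p R"
      "c \<in> quad_field p" "c \<noteq> 0" "M = (*) c ` L" by (auto simp: homothety_rel_def)
    have "L = (*) (inverse c) ` M" using c by (simp add: image_image flip: mult.assoc)
    moreover have "inverse c \<in> quad_field p - {0}" using c quad_field_inverse by simp
    ultimately show "(M, L) \<in> homothety_rel p R" using c(1,2) unfolding homothety_rel_def by blast
  qed
  show "trans (homothety_rel p R)"
  proof (rule transI)
    fix L M N assume "(L, M) \<in> homothety_rel p R" "(M, N) \<in> homothety_rel p R"
    then obtain c d where c: "L \<in> proper_ideals p R" "N \<in> proper_ideals p R"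
      "c \<in> quad_field p" "c \<noteq> 0" "M = (*) c ` L"
      "d \<in> quad_field p" "d \<noteq> 0" "N = (*) d ` M" by (auto simp: homothety_rel_def)
    have "N = (*) (d * c) ` L" using c by (simp add: image_image mult.assoc)
    moreover have "d * c \<in> quad_field p - {0}" using c quad_field_mult by simp
    ultimately show "(L, N) \<in> homothety_rel p R" using c(1,2) unfolding homothety_rel_def by blast
  qed
qed

lemma ideal_class_eq_iff:
  assumes "L \<in> proper_ideals p R" "M \<in> proper_ideals p R"
  shows "ideal_class p R L = ideal_class p R M \<longleftrightarrow> (\<exists>c \<in> quad_field p - {0}. M = (*) c ` L)"
  unfolding ideal_class_def
  using eq_equiv_class_iff[OF equiv_homothety_rel assms] assms by (auto simp: homothety_rel_def)

section \<open>Fixed points of the Fricke involution as quadratic irrationalities\<close>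

text \<open>
  The root \<open>\<tau>\<close> in the upper half-plane of the positive definite form \<open>[p c, -2 p a, b]\<close> of
  discriminant \<open>-4p\<close>. The linear equation, unlike the quadratic one, fixes the sign of the
  square root, so that \<open>c > 0\<close> already forces \<open>Im \<tau> > 0\<close>.
\<close>

definition fricke_form :: "nat \<Rightarrow> int \<Rightarrow> int \<Rightarrow> int \<Rightarrow> complex \<Rightarrow> bool" where
  "fricke_form p a b c \<tau> \<longleftrightarrow> c > 0 \<and> b * c = int p * a\<^sup>2 + 1 \<and>
     of_int (int p * c) * \<tau> = of_int (int p * a) + sqrt_neg p"

definition fricke_points :: "nat \<Rightarrow> complex set" where
  "fricke_points p = {\<tau>. \<exists>a b c. fricke_form p a b c \<tau>}"

lemma fricke_form_Im:
  assumes "p > 0" "fricke_form p a b c \<tau>"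
  shows "Im \<tau> > 0"
proof -
  have "Im (of_int (int p * c) * \<tau>) = Im (of_int (int p * a) + sqrt_neg p)"
    using assms by (simp only: fricke_form_def)
  hence "real_of_int (int p * c) * Im \<tau> > 0" using assms by (simp add: Im_sqrt_neg)
  moreover have "real_of_int (int p * c) > 0" using assms by (simp add: fricke_form_def)
  ultimately show ?thesis using zero_less_mult_pos by blast
qed

text \<open>
  The matrix of multiplication by \<open>sqrt(-p)\<close> on \<open>[1, \<tau>]\<close>. Modulo \<open>p\<close> it sends \<open>1\<close> to \<open>0\<close> and
  \<open>\<tau>\<close> to the unit \<open>- b\<close>; this is the coordinate form of \<open>sqrt(-p) [1, \<tau>] = [1, p\<tau>]\<close>.
\<close>

lemma fricke_form_sqrt_neg:
  assumes "p > 0" "fricke_form p a b c \<tau>"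
  shows "sqrt_neg p = of_int (int p * c) * \<tau> - of_int (int p * a)"
    and "sqrt_neg p * \<tau> = of_int (int p * a) * \<tau> - of_int b"
    and "of_int (int p * c) * (\<tau> * \<tau>) = of_int (2 * int p * a) * \<tau> - of_int b"
proof -
  define s where "s = sqrt_neg p"
  show s1: "sqrt_neg p = of_int (int p * c) * \<tau> - of_int (int p * a)"
    using assms by (simp add: fricke_form_def)
  have e: "of_int (int p * c) * \<tau> = of_int (int p * a) + s"
    using assms by (simp only: fricke_form_def s_def)
  have "of_int (b * c) = (of_int (int p * a\<^sup>2 + 1) :: complex)"
    using assms by (simp only: fricke_form_def)
  hence bc: "of_int b * of_int c = of_nat p * of_int a * of_int a + (1::complex)"
    by (simp add: power2_eq_square)
  have ss: "s * s = - of_nat p" by (simp add: s_def sqrt_neg_mult_self)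
  have "of_int (int p * c) * (s * \<tau>) = s * (of_int (int p * a) + s)"
    using e by (metis mult.left_commute)
  also have "\<dots> = of_int (int p * a) * s - of_nat p" by (simp add: algebra_simps ss)
  also have "\<dots> = of_int (int p * a) * (of_int (int p * a) + s)
      - of_nat p * (of_nat p * of_int a * of_int a + 1)" by (simp add: algebra_simps)
  also have "\<dots> = of_int (int p * c) * (of_int (int p * a) * \<tau> - of_int b)"
    unfolding e[symmetric] bc[symmetric] by (simp add: algebra_simps)
  finally have "of_int (int p * c) * (s * \<tau>) =
    of_int (int p * c) * (of_int (int p * a) * \<tau> - of_int b)" .
  moreover have "of_int (int p * c) \<noteq> (0::complex)" using assms by (simp add: fricke_form_def)
  ultimately show s2: "sqrt_neg p * \<tau> = of_int (int p * a) * \<tau> - of_int b"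
    unfolding s_def using mult_left_cancel by blast
  have "of_int (int p * c) * (\<tau> * \<tau>) = (of_int (int p * a) + s) * \<tau>"
    using e by (metis mult.assoc)
  thus "of_int (int p * c) * (\<tau> * \<tau>) = of_int (2 * int p * a) * \<tau> - of_int b"
    using s2 by (simp add: s_def algebra_simps)
qed

lemma fricke_form_quad_field:
  assumes "p > 0" "fricke_form p a b c \<tau>"
  shows "\<tau> \<in> quad_field p"
proof -
  have "of_int (int p * c) \<noteq> (0::complex)" using assms by (simp add: fricke_form_def)
  hence "\<tau> = inverse (of_int (int p * c)) * (of_int (int p * a) + sqrt_neg p)"
    using assms(2) unfolding fricke_form_def by (simp add: field_simps)
  thus ?thesis
    by (metis quad_field_mult quad_field_inverse quad_field_of_int quad_field_add quad_field_sqrt_neg)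
qed

lemma fricke_class_fixed_iff:
  assumes "p > 0" "x \<in> Hstar"
  shows "fricke p (Gamma0_rel p `` {x}) = Gamma0_rel p `` {x} \<longleftrightarrow>
         (\<exists>A \<in> Gamma0 p. mob (omega p ** A) x = x)"
proof -
  have "fricke p (Gamma0_rel p `` {x}) = Gamma0_rel p `` {x} \<longleftrightarrow>
      (mob (omega p) x, x) \<in> Gamma0_rel p"
    using assms mob_omega_Hstar by (simp add: fricke_class eq_equiv_class_iff[OF equiv_Gamma0_rel])
  also have "\<dots> \<longleftrightarrow> (x, mob (omega p) x) \<in> Gamma0_rel p"
    using equiv_Gamma0_rel by (meson equivE symE)
  also have "\<dots> \<longleftrightarrow> (\<exists>A \<in> Gamma0 p. mob (omega p) x = mob A x)"
    using assms mob_omega_Hstar by (auto simp: Gamma0_rel_def)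
  also have "\<dots> \<longleftrightarrow> (\<exists>A \<in> Gamma0 p. mob (omega p) (mob A x) = x)"
    using mob_omega_omega[OF assms(1)] by metis
  also have "\<dots> \<longleftrightarrow> (\<exists>A \<in> Gamma0 p. mob (omega p ** A) x = x)"
    using assms by (intro bex_cong refl) (auto simp: mob_mult det_omega Gamma0_def)
  finally show ?thesis .
qed

lemma omega_mult_entries:
  "(omega p ** A)$1$1 = A$2$1" "(omega p ** A)$1$2 = A$2$2"
  "(omega p ** A)$2$1 = - int p * A$1$1" "(omega p ** A)$2$2 = - int p * A$1$2"
  by (simp_all add: omega_def matrix_matrix_mult_def sum_2)

text \<open>
  The discriminant of the fixed-point equation of \<open>\<omega>\<^sub>p A\<close>: with \<open>p k\<close> the lower-left and \<open>b\<close> the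
  upper-right entry of \<open>A\<close>, that matrix has trace \<open>p (k - b)\<close> and determinant \<open>p\<close>.
\<close>

lemma omega_fixed_finite:
  assumes "A \<in> Gamma0 p" "mob (omega p ** A) (Fin z) = Fin z"
  obtains a b k d :: int where "a * d = int p * (b * k) + 1"
    "(of_int (2 * int p * a) * z + of_int (int p * (b + k)))\<^sup>2
       = of_int ((int p)\<^sup>2 * (k - b)\<^sup>2 - 4 * int p)"
proof -
  from assms(1) obtain k where k: "A$2$1 = int p * k" and "det A = 1" by (auto simp: Gamma0_def)
  define a b d where "a = A$1$1" "b = A$1$2" "d = A$2$2"
  note abd = this
  have 1: "a * d = int p * (b * k) + 1" using \<open>det A = 1\<close> k by (simp add: det_2 abd algebra_simps)
  have n: "of_int (- int p * a) * z + of_int (- int p * b) \<noteq> 0"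
    and e: "moebius (of_int (int p * k)) (of_int d) (of_int (- int p * a)) (of_int (- int p * b)) z = z"
    using assms(2) by (auto simp: omega_mult_entries k abd split: if_splits)
  have "of_int (int p * k) * z + of_int d =
      z * (of_int (- int p * a) * z + of_int (- int p * b))"
    using e n unfolding moebius_def by (metis nonzero_divide_eq_eq)
  moreover have "of_int (int p * a) * (z * z) + of_int (int p * (b + k)) * z + of_int d =
      of_int (int p * k) * z + of_int d - z * (of_int (- int p * a) * z + of_int (- int p * b))"
    by (simp add: algebra_simps)
  ultimately have 2: "of_int (int p * a) * (z * z) + of_int (int p * (b + k)) * z + of_int d = 0"
    by (simp only: diff_self)
  have ad: "of_int a * of_int d = of_nat p * (of_int b * of_int k) + (1::complex)"
    using arg_cong[OF 1, of "of_int :: int \<Rightarrow> complex"] by simp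
  have "(of_int (2 * int p * a) * z + of_int (int p * (b + k)))\<^sup>2 =
    4 * of_nat p * of_int a * (of_int (int p * a) * (z * z) + of_int (int p * (b + k)) * z + of_int d)
    + (of_nat p)\<^sup>2 * (of_int b + of_int k)\<^sup>2 - 4 * of_nat p * (of_int a * of_int d)"
    by (simp add: power2_eq_square algebra_simps)
  also have "\<dots> = of_int ((int p)\<^sup>2 * (k - b)\<^sup>2 - 4 * int p)"
    unfolding 2 ad by (simp add: power2_eq_square algebra_simps)
  finally show ?thesis using 1 that by blast
qed

text \<open>
  As \<open>p\<close> does not divide \<open>4\<close>, it divides the discriminant \<open>p\<^sup>2 t\<^sup>2 - 4p\<close> exactly once, so
  this number is not the square of a rational.
\<close>

lemma no_rational_fixed_point:
  assumes "prime p" "odd p" "A \<in> Gamma0 p" "z \<in> \<rat>"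
  shows "mob (omega p ** A) (Fin z) \<noteq> Fin z"
proof
  assume "mob (omega p ** A) (Fin z) = Fin z"
  from omega_fixed_finite[OF assms(3) this] obtain a b k d :: int where
    w: "(of_int (2 * int p * a) * z + of_int (int p * (b + k)))\<^sup>2
       = of_int ((int p)\<^sup>2 * (k - b)\<^sup>2 - 4 * int p)" by metis
  have "of_int (2 * int p * a) * z + of_int (int p * (b + k)) \<in> \<rat>"
    using assms(4) by (intro Rats_add Rats_mult Rats_of_int)
  then obtain u v :: int where uv: "v > 0" "coprime u v"
    "of_int (2 * int p * a) * z + of_int (int p * (b + k)) = of_int u / of_int v"
    by (rule Rats_cases')
  have "of_int (u\<^sup>2) = (of_int (((int p)\<^sup>2 * (k - b)\<^sup>2 - 4 * int p) * v\<^sup>2) :: complex)"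
    using w uv(1) unfolding uv(3) by (simp add: field_simps)
  hence u: "u\<^sup>2 = int p * ((int p * (k - b)\<^sup>2 - 4) * v\<^sup>2)"
    unfolding of_int_eq_iff by (simp add: power2_eq_square algebra_simps)
  have p: "prime (int p)" using assms by simp
  hence "int p dvd u" using u by (metis dvd_triv_left prime_dvd_power)
  hence "\<not> int p dvd v" using uv(2) p by (meson coprime_common_divisor not_prime_unit)
  from \<open>int p dvd u\<close> obtain j where "u = int p * j" by blast
  hence "int p * ((int p * (k - b)\<^sup>2 - 4) * v\<^sup>2) = int p * (int p * j\<^sup>2)"
    unfolding u[symmetric] by (simp only: power2_eq_square mult_ac)
  moreover have "int p \<noteq> 0" using p by auto
  ultimately have "(int p * (k - b)\<^sup>2 - 4) * v\<^sup>2 = int p * j\<^sup>2"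
    using mult_left_cancel by blast
  hence "int p dvd (int p * (k - b)\<^sup>2 - 4)"
    using p \<open>\<not> int p dvd v\<close> by (metis dvd_triv_left prime_dvd_mult_iff prime_dvd_power)
  then obtain i where "int p * (k - b)\<^sup>2 - 4 = int p * i" by blast
  hence "int 4 = int p * ((k - b)\<^sup>2 - i)" by (simp add: algebra_simps)
  hence "int p dvd int 4" by (metis dvd_triv_left)
  hence "p dvd 2 ^ 2" by (simp only: int_dvd_int_iff) simp
  hence "p dvd 2" using assms(1) prime_dvd_power by blast
  thus False using assms by (metis primes_dvd_imp_eq two_is_prime_nat)
qed

lemma omega_fixed_Infty:
  assumes "prime p" "A \<in> Gamma0 p"
  shows "mob (omega p ** A) Infty \<noteq> Infty"
proof
  assume "mob (omega p ** A) Infty = Infty"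
  hence "A$1$1 = 0" using assms(1) by (auto simp: omega_mult_entries split: if_splits)
  hence "int p dvd A$2$1" "A$1$2 * A$2$1 = - 1" using assms(2) by (auto simp: Gamma0_def det_2)
  hence "int p dvd 1" by (metis dvd_minus_iff dvd_mult)
  thus False using assms(1) by auto
qed

lemma fricke_formI_square:
  fixes a b d :: int
  assumes "p > 0" "Im z > 0" "a * d = int p * b\<^sup>2 + 1"
    "(of_int (int p * a) * z + of_int (int p * b))\<^sup>2 = - of_nat p"
  shows "z \<in> fricke_points p"
proof -
  define w where "w = of_int (int p * a) * z + of_int (int p * b)"
  have "(w - sqrt_neg p) * (w + sqrt_neg p) = 0"
    using assms(4) sqrt_neg_mult_self[of p] by (simp add: w_def power2_eq_square algebra_simps)
  hence w: "w = sqrt_neg p \<or> w = - sqrt_neg p" by (auto simp: eq_neg_iff_add_eq_0)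
  have Imw: "Im w = of_int (int p * a) * Im z" by (simp add: w_def)
  from w show ?thesis
  proof
    assume w: "w = sqrt_neg p"
    hence "of_int (int p * a) * Im z > 0"
      using assms(1) Imw by (metis Im_sqrt_neg of_nat_0_less_iff real_sqrt_gt_zero)
    hence "a > 0" using assms by (simp add: zero_less_mult_iff)
    hence "fricke_form p (- b) d a z"
      using assms(3) w by (auto simp: fricke_form_def w_def algebra_simps)
    thus ?thesis by (auto simp: fricke_points_def)
  next
    assume w: "w = - sqrt_neg p"
    hence "of_int (int p * a) * Im z = - sqrt (real p)" by (simp only: Im_sqrt_neg uminus_complex.sel flip: Imw)
    moreover have "sqrt (real p) > 0" using assms(1) by simp
    ultimately have "of_int (int p * a) * Im z < 0" by linarith
    hence "a < 0" using assms by (simp add: mult_less_0_iff)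
    moreover have "of_int (int p * (- a)) * z = of_int (int p * b) + - w"
      by (simp add: w_def algebra_simps)
    ultimately have "fricke_form p b (- d) (- a) z"
      using assms(3) by (simp add: fricke_form_def w algebra_simps)
    thus ?thesis by (auto simp: fricke_points_def)
  qed
qed

text \<open>
  For a fixed point in the upper half-plane the discriminant is negative, so \<open>p t\<^sup>2 < 4\<close>. Apart
  from \<open>t = 0\<close> this leaves \<open>p = 3\<close>, \<open>t = \<plusminus>1\<close>, where the fixed point is also an elliptic point of
  order \<open>3\<close>. There \<open>M\<^sup>2 = 3tM - 3\<close>, and \<open>2M - 3t\<close> is a matrix of trace \<open>0\<close> and determinant \<open>3\<close>
  with the same fixed point, which is what the doubled coefficients in the last case express.
\<close>

lemma omega_fixed_imp_fricke_point:
  assumes "prime p" "odd p" "A \<in> Gamma0 p" "Im z > 0" "mob (omega p ** A) (Fin z) = Fin z"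
  shows "z \<in> fricke_points p"
proof -
  have p: "p > 2" using assms(1,2) by (metis prime_ge_2_nat le_neq_implies_less dvd_refl)
  from omega_fixed_finite[OF assms(3,5)] obtain a b k d :: int where
    ad: "a * d = int p * (b * k) + 1" and
    w: "(of_int (2 * int p * a) * z + of_int (int p * (b + k)))\<^sup>2
       = of_int ((int p)\<^sup>2 * (k - b)\<^sup>2 - 4 * int p)" by metis
  define u where "u = of_int (2 * int p * a) * z + of_int (int p * (b + k))"
  have "a \<noteq> 0"
  proof
    assume "a = 0"
    hence "int p * (b * k) = - 1" using ad by simp
    hence "int p dvd 1" by (metis dvd_minus_iff dvd_triv_left)
    thus False using p by simp
  qed
  hence Imu: "Im u \<noteq> 0" using assms(4) p by (simp add: u_def)
  \<comment> \<open>A non-real number with real square is purely imaginary, so its square is negative.\<close>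
  have "Im (u\<^sup>2) = 0" using w by (simp add: u_def)
  hence "Re u = 0" using Imu by (simp add: power2_eq_square)
  moreover have "Re (u\<^sup>2) = of_int ((int p)\<^sup>2 * (k - b)\<^sup>2 - 4 * int p)"
    unfolding u_def w by simp
  ultimately have "real_of_int ((int p)\<^sup>2 * (k - b)\<^sup>2 - 4 * int p) = - (Im u * Im u)"
    by (simp add: power2_eq_square)
  moreover have "Im u * Im u > 0" using Imu not_real_square_gt_zero by blast
  ultimately have "real_of_int ((int p)\<^sup>2 * (k - b)\<^sup>2 - 4 * int p) < 0" by linarith
  hence "int p * (int p * (k - b)\<^sup>2 - 4) < 0"
    unfolding of_int_less_0_iff by (simp add: power2_eq_square algebra_simps)
  hence lt: "int p * (k - b)\<^sup>2 < 4" using p by (simp add: mult_less_0_iff)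
  show ?thesis
  proof (cases "k = b")
    case True
    have "4 * (of_int (int p * a) * z + of_int (int p * b))\<^sup>2 = 4 * (- of_nat p)"
      using w True by (simp add: power2_eq_square algebra_simps)
    hence "(of_int (int p * a) * z + of_int (int p * b))\<^sup>2 = - of_nat p"
      unfolding mult_left_cancel[OF zero_neq_numeral[symmetric]] .
    with ad True p show ?thesis
      by (intro fricke_formI_square[OF _ assms(4)]) (auto simp: power2_eq_square)
  next
    case False
    hence ge: "(k - b)\<^sup>2 \<ge> 1" using zero_less_power2[of "k - b"] by linarith
    hence "int p * 1 \<le> int p * (k - b)\<^sup>2" by (intro mult_left_mono) auto
    hence p3: "p = 3" using lt p by linarith
    hence t: "(k - b)\<^sup>2 = 1" using lt ge by simp
    show ?thesis
    proof (rule fricke_formI_square[OF _ assms(4)])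
      show "(2 * a) * (2 * d) = int p * (b + k)\<^sup>2 + 1"
        using ad t p3 by (simp add: power2_eq_square algebra_simps)
      show "(of_int (int p * (2 * a)) * z + of_int (int p * (b + k)))\<^sup>2 = - of_nat p"
        using w unfolding t p3 by (simp add: algebra_simps)
    qed (use p in auto)
  qed
qed

lemma fricke_point_imp_omega_fixed:
  assumes "p > 0" "fricke_form p a b c \<tau>"
  shows "\<exists>A \<in> Gamma0 p. mob (omega p ** A) (Fin \<tau>) = Fin \<tau>"
proof
  \<comment> \<open>Chosen so that \<open>omega p ** A\<close> is the matrix of multiplication by \<open>sqrt(-p)\<close>.\<close>
  define A :: "int^2^2" where "A = vector [vector [- c, a], vector [int p * a, - b]]"
  show "A \<in> Gamma0 p"
    using assms by (auto simp: Gamma0_def det_2 A_def fricke_form_def power2_eq_square algebra_simps)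
  have c: "c > 0" using assms by (simp add: fricke_form_def)
  have "Im (of_int (int p * c) * \<tau> + of_int (- int p * a)) \<noteq> 0"
    using c assms(1) fricke_form_Im[OF assms] by simp
  hence n: "of_int (int p * c) * \<tau> + of_int (- int p * a) \<noteq> 0" by (metis zero_complex.sel(2))
  have "of_int (int p * a) * \<tau> + of_int (- b) =
      \<tau> * (of_int (int p * c) * \<tau> + of_int (- int p * a))"
    using fricke_form_sqrt_neg(3)[OF assms] by (simp add: algebra_simps)
  hence "moebius (of_int (int p * a)) (of_int (- b)) (of_int (int p * c)) (of_int (- int p * a)) \<tau> = \<tau>"
    unfolding moebius_def using n by (simp add: nonzero_divide_eq_eq)
  moreover have "(omega p ** A)$1$1 = int p * a" "(omega p ** A)$1$2 = - b"
    "(omega p ** A)$2$1 = int p * c" "(omega p ** A)$2$2 = - int p * a"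
    unfolding omega_mult_entries by (simp_all add: A_def)
  ultimately show "mob (omega p ** A) (Fin \<tau>) = Fin \<tau>"
    using n by (simp only: mob.simps if_False)
qed

lemma ramification_points_eq:
  assumes "prime p" "odd p"
  shows "ramification_points p = cls0 p ` fricke_points p"
proof (intro set_eqI iffI)
  have p: "p > 0" using assms by (simp add: prime_gt_0_nat)
  fix P
  {
    assume "P \<in> ramification_points p"
    hence P: "P \<in> X0 p" "fricke p P = P" by (auto simp: ramification_points_def)
    from P(1) obtain x where x: "x \<in> Hstar" "P = Gamma0_rel p `` {x}"
      by (auto simp: X0_def elim!: quotientE)
    from P(2) obtain A where A: "A \<in> Gamma0 p" "mob (omega p ** A) x = x"
      unfolding x(2) fricke_class_fixed_iff[OF p x(1)] by blast
    have "x \<noteq> Infty" using A omega_fixed_Infty[OF assms(1)] by auto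
    then obtain z where z: "x = Fin z" by (cases x) auto
    have "z \<notin> \<rat>" using A no_rational_fixed_point[OF assms A(1)] z by auto
    hence "Im z > 0" using x(1) by (auto simp: z Hstar_def)
    hence "z \<in> fricke_points p" using omega_fixed_imp_fricke_point[OF assms A(1)] A z by auto
    thus "P \<in> cls0 p ` fricke_points p" by (auto simp: x z cls0_def)
  }
  {
    assume "P \<in> cls0 p ` fricke_points p"
    then obtain \<tau> a b c where t: "P = Gamma0_rel p `` {Fin \<tau>}" "fricke_form p a b c \<tau>"
      by (auto simp: fricke_points_def cls0_def)
    have "Fin \<tau> \<in> Hstar" using fricke_form_Im[OF p t(2)] by (auto simp: Hstar_def)
    thus "P \<in> ramification_points p"
      using fricke_point_imp_omega_fixed[OF p t(2)] fricke_class_fixed_iff[OF p]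
      by (auto simp: ramification_points_def t(1) X0_def intro: quotientI)
  }
qed

lemma cls0_ramification_iff:
  assumes "prime p" "odd p" "Im \<tau> > 0"
  shows "cls0 p \<tau> \<in> ramification_points p \<longleftrightarrow> \<tau> \<in> fricke_points p"
proof
  have p: "p > 0" using assms by (simp add: prime_gt_0_nat)
  have H: "Fin \<tau> \<in> Hstar" using assms by (auto simp: Hstar_def)
  assume "cls0 p \<tau> \<in> ramification_points p"
  then obtain A where "A \<in> Gamma0 p" "mob (omega p ** A) (Fin \<tau>) = Fin \<tau>"
    using fricke_class_fixed_iff[OF p H] by (auto simp: ramification_points_def cls0_def)
  thus "\<tau> \<in> fricke_points p" using omega_fixed_imp_fricke_point assms by blast
qed (use ramification_points_eq[OF assms(1,2)] in auto)

section \<open>Classes of fixed points and homothety of lattices\<close>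

lemma cls0_eq_imp_homothetic:
  assumes "Im \<tau> > 0" "Im \<sigma> > 0" "cls0 p \<tau> = cls0 p \<sigma>"
  shows "\<exists>\<mu>. \<mu> \<noteq> 0 \<and> zspan2 1 \<tau> = (*) \<mu> ` zspan2 1 \<sigma>"
proof -
  have "(Fin \<tau>, Fin \<sigma>) \<in> Gamma0_rel p"
    using assms eq_equiv_class_iff[OF equiv_Gamma0_rel, of "Fin \<tau>" "Fin \<sigma>" p]
    by (auto simp: cls0_def Hstar_def)
  then obtain A where A: "A \<in> Gamma0 p" "Fin \<sigma> = mob A (Fin \<tau>)" by (auto simp: Gamma0_rel_def)
  define a b c d where abcd: "a = A$1$1" "b = A$1$2" "c = A$2$1" "d = A$2$2"
  define \<mu> where "\<mu> = of_int c * \<tau> + of_int d"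
  have \<mu>: "\<mu> \<noteq> 0" and s: "\<sigma> = (of_int a * \<tau> + of_int b) / \<mu>"
    using A(2) by (auto simp: abcd \<mu>_def moebius_def split: if_splits)
  have "a * d - b * c = 1" using A(1) by (simp add: Gamma0_def det_2 abcd)
  hence det: "of_int a * of_int d - of_int b * of_int c = (1::complex)"
    by (metis of_int_1 of_int_diff of_int_mult)
  have ms: "\<mu> * \<sigma> = of_int a * \<tau> + of_int b" using s \<mu> by simp
  have "zspan2 1 \<tau> = zspan2 \<mu> (\<mu> * \<sigma>)"
  proof
    have "1 = of_int a * \<mu> + of_int (- c) * (\<mu> * \<sigma>)"
      unfolding ms unfolding \<mu>_def using det by (simp add: algebra_simps)
    hence "1 \<in> zspan2 \<mu> (\<mu> * \<sigma>)" using zspan2I by metis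
    moreover have "\<tau> = (of_int a * of_int d - of_int b * of_int c) * \<tau>" by (simp only: det mult_1)
    hence "\<tau> = of_int (- b) * \<mu> + of_int d * (\<mu> * \<sigma>)"
      unfolding ms unfolding \<mu>_def by (simp add: algebra_simps)
    hence "\<tau> \<in> zspan2 \<mu> (\<mu> * \<sigma>)" using zspan2I by metis
    ultimately show "zspan2 1 \<tau> \<subseteq> zspan2 \<mu> (\<mu> * \<sigma>)" by (rule zspan2_subset)
    have "\<mu> \<in> zspan2 1 \<tau>" "\<mu> * \<sigma> \<in> zspan2 1 \<tau>"
      using zspan2I[of d 1 c \<tau>] zspan2I[of b 1 a \<tau>] unfolding ms unfolding \<mu>_def
      by (simp_all add: add.commute)
    thus "zspan2 \<mu> (\<mu> * \<sigma>) \<subseteq> zspan2 1 \<tau>" by (rule zspan2_subset)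
  qed
  thus ?thesis using \<mu> by (auto simp: zspan2_scale)
qed

text \<open>
  A homothety gives a matrix of \<open>SL\<^sub>2(\<int>)\<close> from \<open>\<tau>\<close> to \<open>\<sigma>\<close>. Multiplication by \<open>\<mu>\<close> commutes with
  multiplication by \<open>sqrt(-p)\<close>, so it also carries \<open>sqrt(-p) [1, \<sigma>] = [1, p\<sigma>]\<close> to \<open>[1, p\<tau>]\<close>;
  hence \<open>\<mu>\<close> lies in \<open>[1, p\<tau>]\<close>, and its \<open>\<tau>\<close>-coefficient \<open>k\<close>, the lower-left entry of the matrix,
  is divisible by \<open>p\<close>.
\<close>

lemma homothetic_imp_cls0_eq:
  assumes "prime p" "fricke_form p a b c \<tau>" "fricke_form p a' b' c' \<sigma>"
    and "\<mu> \<noteq> 0" "zspan2 1 \<tau> = (*) \<mu> ` zspan2 1 \<sigma>"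
  shows "cls0 p \<tau> = cls0 p \<sigma>"
proof -
  have p: "p > 0" using assms by (simp add: prime_gt_0_nat)
  have It: "Im \<tau> > 0" and Is: "Im \<sigma> > 0" using fricke_form_Im p assms by auto
  have eq: "zspan2 1 \<tau> = zspan2 \<mu> (\<mu> * \<sigma>)" using assms by (simp add: zspan2_scale)
  have "\<mu> \<in> zspan2 1 \<tau>" "\<mu> * \<sigma> \<in> zspan2 1 \<tau>" unfolding eq by (rule zspan2_gens)+
  then obtain k l m n where kl: "\<mu> = of_int l + of_int k * \<tau>" and
    mn: "\<mu> * \<sigma> = of_int n + of_int m * \<tau>" by (auto simp: zspan2_def)
  have "1 \<in> zspan2 \<mu> (\<mu> * \<sigma>)" "\<tau> \<in> zspan2 \<mu> (\<mu> * \<sigma>)" unfolding eq[symmetric] by (rule zspan2_gens)+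
  then obtain k' l' m' n' where e: "1 = of_int l' * \<mu> + of_int k' * (\<mu> * \<sigma>)"
    "\<tau> = of_int n' * \<mu> + of_int m' * (\<mu> * \<sigma>)" by (auto simp: zspan2_def)
  have "of_int 1 + of_int 0 * \<tau> = of_int (l' * l + k' * n) + of_int (l' * k + k' * m) * \<tau>"
    using e(1) unfolding mn unfolding kl by (simp add: algebra_simps)
  hence i1: "l' * l + k' * n = 1" "l' * k + k' * m = 0"
    using zspan2_coeffs_unique[of \<tau>] It by (metis less_irrefl)+
  have "of_int 0 + of_int 1 * \<tau> = of_int (n' * l + m' * n) + of_int (n' * k + m' * m) * \<tau>"
    using e(2) unfolding mn unfolding kl by (simp add: algebra_simps)
  hence i2: "n' * l + m' * n = 0" "n' * k + m' * m = 1"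
    using zspan2_coeffs_unique[of \<tau>] It by (metis less_irrefl)+
  have "(l' * m' - k' * n') * (l * m - k * n) =
     (l' * l + k' * n) * (n' * k + m' * m) - (l' * k + k' * m) * (n' * l + m' * n)"
    by (simp add: algebra_simps)
  hence unit: "(l' * m' - k' * n') * (l * m - k * n) = 1" using i1 i2 by simp
  have s: "\<sigma> = (of_int m * \<tau> + of_int n) / (of_int k * \<tau> + of_int l)"
    using kl mn assms(4) by (metis add.commute nonzero_mult_div_cancel_left)
  have n0: "of_int k * \<tau> + of_int l \<noteq> 0" using kl assms(4) by (simp add: add.commute)
  have "Im \<sigma> = (of_int (m * l - n * k)) * Im \<tau> / (cmod (of_int k * \<tau> + of_int l))\<^sup>2"
    unfolding s Im_divide cmod_power2 by (simp add: algebra_simps)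
  hence "of_int (m * l - n * k) > (0::real)"
    using Is It n0 by (simp add: zero_less_divide_iff zero_less_mult_iff)
  hence "m * l - n * k > 0" by (simp only: of_int_0_less_iff)
  hence det: "m * l - n * k = 1" using unit
    by (metis mult.commute pos_zmult_eq_1_iff)
  have "int p dvd k"
  proof -
    \<comment> \<open>\<open>sqrt(-p) \<mu>\<close> is computed in the basis \<open>1, \<tau>\<close> from both sides; comparing constant terms
        gives \<open>k b \<equiv> 0\<close> modulo \<open>p\<close>, and \<open>b\<close> is a unit modulo \<open>p\<close>.\<close>
    have "sqrt_neg p * \<mu> = of_int (int p * c') * (\<mu> * \<sigma>) - of_int (int p * a') * \<mu>"
      unfolding fricke_form_sqrt_neg(1)[OF p assms(3)] by (simp add: algebra_simps)
    also have "\<dots> = of_int (int p * (c' * n - a' * l)) + of_int (int p * (c' * m - a' * k)) * \<tau>"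
      unfolding mn unfolding kl by (simp add: algebra_simps)
    finally have 1: "sqrt_neg p * \<mu> =
      of_int (int p * (c' * n - a' * l)) + of_int (int p * (c' * m - a' * k)) * \<tau>" .
    have "sqrt_neg p * \<mu> = of_int l * sqrt_neg p + of_int k * (sqrt_neg p * \<tau>)"
      unfolding kl by (simp add: algebra_simps)
    also have "\<dots> = of_int (- int p * a * l - k * b) + of_int (int p * c * l + int p * a * k) * \<tau>"
      unfolding fricke_form_sqrt_neg(2)[OF p assms(2)]
      by (subst fricke_form_sqrt_neg(1)[OF p assms(2)]) (simp add: algebra_simps)
    finally have "int p * (c' * n - a' * l) = - int p * a * l - k * b"
      using 1 zspan2_coeffs_unique(1)[of \<tau>] It by (metis less_irrefl)
    hence "k * b = int p * (- a * l - c' * n + a' * l)" by (simp add: algebra_simps)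
    moreover have "b * c = int p * a\<^sup>2 + 1" using assms(2) by (simp add: fricke_form_def)
    ultimately have "k = int p * ((- a * l - c' * n + a' * l) * c - k * a\<^sup>2)"
      by algebra
    thus ?thesis by (metis dvd_triv_left)
  qed
  define A :: "int^2^2" where "A = vector [vector [m, n], vector [k, l]]"
  have "A \<in> Gamma0 p" using det \<open>int p dvd k\<close> by (simp add: Gamma0_def A_def det_2)
  moreover have "mob A (Fin \<tau>) = Fin \<sigma>" using n0 s by (simp add: A_def moebius_def)
  ultimately have "(Fin \<tau>, Fin \<sigma>) \<in> Gamma0_rel p"
    using It Is by (force simp: Gamma0_rel_def Hstar_def)
  thus ?thesis unfolding cls0_def by (rule equiv_class_eq[OF equiv_Gamma0_rel])
qed

lemma cls0_eq_iff_homothetic: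
  assumes "prime p" "\<tau> \<in> fricke_points p" "\<sigma> \<in> fricke_points p"
  shows "cls0 p \<tau> = cls0 p \<sigma> \<longleftrightarrow> (\<exists>\<mu> \<in> quad_field p - {0}. zspan2 1 \<sigma> = (*) \<mu> ` zspan2 1 \<tau>)"
proof
  have p: "p > 0" using assms by (simp add: prime_gt_0_nat)
  from assms obtain a b c a' b' c' where f: "fricke_form p a b c \<tau>" "fricke_form p a' b' c' \<sigma>"
    by (auto simp: fricke_points_def)
  note Im = fricke_form_Im[OF p f(1)] fricke_form_Im[OF p f(2)]
  {
    assume "cls0 p \<tau> = cls0 p \<sigma>"
    then obtain \<mu> where \<mu>: "\<mu> \<noteq> 0" "zspan2 1 \<sigma> = (*) \<mu> ` zspan2 1 \<tau>"
      using cls0_eq_imp_homothetic[OF Im(2,1)] by metis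
    have "\<mu> * 1 \<in> zspan2 1 \<sigma>" unfolding \<mu>(2) by (intro imageI zspan2_gens)
    hence "\<mu> \<in> quad_field p"
      using zspan2_quad_field[OF quad_field_of_int[of 1] fricke_form_quad_field[OF p f(2)]] by auto
    thus "\<exists>\<mu> \<in> quad_field p - {0}. zspan2 1 \<sigma> = (*) \<mu> ` zspan2 1 \<tau>" using \<mu> by blast
  }
  assume "\<exists>\<mu> \<in> quad_field p - {0}. zspan2 1 \<sigma> = (*) \<mu> ` zspan2 1 \<tau>"
  thus "cls0 p \<tau> = cls0 p \<sigma>" using homothetic_imp_cls0_eq[OF assms(1) f(2,1)] by auto
qed

lemma zspan2_swap: "zspan2 x y = zspan2 y x"
  by (intro equalityI zspan2_subset zspan2_gens)

lemma zspan2_uminus: "zspan2 x (- y) = zspan2 x y"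
proof -
  have "- y \<in> zspan2 x y" for y using zspan2_of_int_mult[OF zspan2_gens(2)[of y x], of "-1"] by simp
  from this[of y] this[of "- y"] show ?thesis
    by (intro equalityI zspan2_subset zspan2_gens) simp_all
qed

text \<open>
  \<open>sqrt(-p)\<close> is a non-real root of the characteristic polynomial of this integral matrix, which
  must therefore be \<open>T\<^sup>2 + p\<close>.
\<close>

lemma sqrt_neg_stable_matrix:
  fixes \<alpha> \<beta> \<gamma> \<delta> :: int
  assumes "p > 0" "x \<noteq> 0" "y \<noteq> 0"
    and "sqrt_neg p * x = of_int \<alpha> * x + of_int \<beta> * y"
    and "sqrt_neg p * y = of_int \<gamma> * x + of_int \<delta> * y"
  shows "\<delta> = - \<alpha>" "\<alpha>\<^sup>2 + \<beta> * \<gamma> = - int p"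
proof -
  define s where "s = sqrt_neg p"
  have "(s - of_int \<alpha>) * x = of_int \<beta> * y" "(s - of_int \<delta>) * y = of_int \<gamma> * x"
    using assms(4,5) by (simp_all add: s_def algebra_simps)
  hence "((s - of_int \<alpha>) * (s - of_int \<delta>)) * (x * y) = (of_int \<beta> * of_int \<gamma>) * (x * y)"
    by (metis mult.commute mult.left_commute)
  hence "(s - of_int \<alpha>) * (s - of_int \<delta>) = of_int \<beta> * of_int \<gamma>" using assms(2,3) by simp
  hence e: "s * s - of_int (\<alpha> + \<delta>) * s + of_int (\<alpha> * \<delta> - \<beta> * \<gamma>) = 0" by (simp add: algebra_simps)
  have ss: "s * s = - of_nat p" by (simp add: s_def sqrt_neg_mult_self)
  have "Im (s * s - of_int (\<alpha> + \<delta>) * s + of_int (\<alpha> * \<delta> - \<beta> * \<gamma>)) = 0" by (simp only: e zero_complex.sel)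
  hence "real_of_int (\<alpha> + \<delta>) * sqrt (real p) = 0" unfolding ss by (simp add: s_def Im_sqrt_neg)
  hence "real_of_int (\<alpha> + \<delta>) = 0" using assms(1) by simp
  thus d: "\<delta> = - \<alpha>" by linarith
  have "of_int (- int p + (\<alpha> * \<delta> - \<beta> * \<gamma>)) = (0::complex)" using e ss d by simp
  hence "- int p + (\<alpha> * \<delta> - \<beta> * \<gamma>) = 0" by (simp only: of_int_eq_0_iff)
  thus "\<alpha>\<^sup>2 + \<beta> * \<gamma> = - int p" using d by (simp add: power2_eq_square)
qed

text \<open>
  Modulo \<open>p\<close> the matrix of multiplication by \<open>sqrt(-p)\<close> has trace and determinant \<open>0\<close>, hence is
  nilpotent. So some primitive vector \<open>x'\<close> is killed modulo \<open>p\<close>, and \<open>x'\<close> will be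
  the vector to scale to \<open>1\<close>.
\<close>

lemma adapted_basis:
  assumes "prime p" "y \<noteq> 0" "x / y \<notin> \<real>" "(*) (sqrt_neg p) ` zspan2 x y \<subseteq> zspan2 x y"
  obtains x' y' where "zspan2 x y = zspan2 x' y'" "x' \<noteq> 0" "y' / x' \<notin> \<real>"
    "\<exists>a c. sqrt_neg p * x' = of_int (int p * a) * x' + of_int (int p * c) * y'"
proof -
  have p: "p > 0" using assms by (simp add: prime_gt_0_nat)
  have pp: "prime (int p)" using assms by simp
  have x0: "x \<noteq> 0" using assms(3) by auto
  have yx: "y / x \<notin> \<real>" using assms(3) by (metis Reals_inverse inverse_divide)
  have "sqrt_neg p * x \<in> zspan2 x y" "sqrt_neg p * y \<in> zspan2 x y"
    using assms(4) zspan2_gens by blast+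
  then obtain \<alpha> \<beta> \<gamma> \<delta> where e: "sqrt_neg p * x = of_int \<alpha> * x + of_int \<beta> * y"
    "sqrt_neg p * y = of_int \<gamma> * x + of_int \<delta> * y" by (auto simp: zspan2_def)
  note m = sqrt_neg_stable_matrix[OF p x0 assms(2) e]
  show ?thesis
  proof (cases "int p dvd \<beta>")
    case True
    have "\<alpha>\<^sup>2 = - int p - \<beta> * \<gamma>" using m(2) by simp
    hence "int p dvd \<alpha>\<^sup>2" using True by simp
    hence "int p dvd \<alpha>" using pp prime_dvd_power by blast
    with True obtain a c where "\<alpha> = int p * a" "\<beta> = int p * c" by (auto simp: dvd_def)
    with e(1) x0 yx show ?thesis by (intro that[of x y]) auto
  next
    case False
    hence "coprime \<beta> (int p)" using pp by (metis coprime_commute prime_imp_coprime)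
    then obtain r l where "r * \<beta> + l * int p = 1" using bezout_int[of \<beta> "int p"] by auto
    then obtain j where j: "\<beta> * r = 1 + int p * j"
      by (intro that[of "- l"]) (simp add: algebra_simps)
    \<comment> \<open>With \<open>r\<close> inverse to \<open>\<beta>\<close> modulo \<open>p\<close>, the vector \<open>t x + y\<close> is mapped to one whose
        \<open>y\<close>-coefficient \<open>t \<beta> - \<alpha>\<close> vanishes modulo \<open>p\<close>; by nilpotency so does the other one.\<close>
    define t where "t = r * \<alpha>"
    define q where "q = j * \<alpha>"
    have t: "t * \<beta> - \<alpha> = int p * q" unfolding t_def q_def using j by algebra
    have "\<beta> * (t * \<alpha> + \<gamma>) = int p * (q * \<alpha> - 1)" using t m(2) by algebra
    hence "int p dvd t * \<alpha> + \<gamma>" using False pp by (metis dvd_triv_left prime_dvd_mult_iff)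
    then obtain g where g: "t * \<alpha> + \<gamma> = int p * g" by blast
    define x' where "x' = of_int t * x + y"
    have span: "zspan2 x y = zspan2 x' x"
    proof
      have "y = of_int 1 * x' + of_int (- t) * x" by (simp add: x'_def)
      hence "y \<in> zspan2 x' x" using zspan2I by metis
      thus "zspan2 x y \<subseteq> zspan2 x' x" by (intro zspan2_subset zspan2_gens)
      have "x' \<in> zspan2 x y" unfolding x'_def using zspan2I[of t x 1 y] by simp
      thus "zspan2 x' x \<subseteq> zspan2 x y" by (intro zspan2_subset zspan2_gens)
    qed
    have quot: "x' / x = of_int t + y / x" using x0 by (simp add: x'_def field_simps)
    hence "x' / x \<notin> \<real>" using yx by (metis Reals_diff Reals_of_int add_diff_cancel_left')
    hence "x' \<noteq> 0" "x / x' \<notin> \<real>" by auto (metis Reals_inverse inverse_divide)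
    moreover have "sqrt_neg p * x' = of_int (int p * q) * x' + of_int (int p * (g - q * t)) * x"
    proof -
      have "sqrt_neg p * x' = of_int t * (sqrt_neg p * x) + sqrt_neg p * y"
        by (simp add: x'_def algebra_simps)
      also have "\<dots> = of_int (t * \<alpha> + \<gamma>) * x + of_int (t * \<beta> - \<alpha>) * y"
        unfolding e m(1) by (simp add: algebra_simps)
      also have "\<dots> = of_int (int p * q) * x' + of_int (int p * (g - q * t)) * x"
        unfolding t g x'_def by (simp add: algebra_simps)
      finally show ?thesis .
    qed
    ultimately show ?thesis using span that by blast
  qed
qed

lemma stable_lattice_homothetic_fricke_point:
  assumes "prime p" "is_lattice L" "L \<subseteq> quad_field p" "(*) (sqrt_neg p) ` L \<subseteq> L"
  obtains \<tau> \<mu> where "\<tau> \<in> fricke_points p" "\<mu> \<in> quad_field p - {0}" "L = (*) \<mu> ` zspan2 1 \<tau>"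
proof -
  have p: "p > 0" using assms by (simp add: prime_gt_0_nat)
  from assms(2) obtain x0 y0 where L0: "y0 \<noteq> 0" "x0 / y0 \<notin> \<real>" "L = zspan2 x0 y0"
    by (auto simp: is_lattice_def)
  from adapted_basis[OF assms(1) L0(1,2)] assms(4) L0(3) obtain x y1 a0 c0 where
    L1: "L = zspan2 x y1" "x \<noteq> 0" "y1 / x \<notin> \<real>"
      "sqrt_neg p * x = of_int (int p * a0) * x + of_int (int p * c0) * y1" by metis
  obtain y c where L: "L = zspan2 x y" "Im (y / x) > 0"
    "sqrt_neg p * x = of_int (int p * a0) * x + of_int (int p * c) * y"
  proof (cases "Im (y1 / x) > 0")
    case False
    have "Im (y1 / x) \<noteq> 0" using L1(3) by (simp add: complex_is_Real_iff)
    with False have "Im (- y1 / x) > 0" by simp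
    with L1 show ?thesis by (intro that[of "- y1" "- c0"]) (auto simp: zspan2_uminus)
  qed (use L1 that in auto)
  have y: "y \<noteq> 0" using L(2) by auto
  have "sqrt_neg p * y \<in> L" using assms(4) zspan2_gens unfolding L by blast
  then obtain \<gamma> \<delta> where e: "sqrt_neg p * y = of_int \<gamma> * x + of_int \<delta> * y"
    unfolding L(1) by (auto simp: zspan2_def)
  note m = sqrt_neg_stable_matrix[OF p L1(2) y L(3) e]
  define \<tau> where "\<tau> = y / x"
  have "int p * (int p * a0\<^sup>2 + c * \<gamma>) = int p * (- 1)"
    using m(2) by (simp add: power2_eq_square algebra_simps)
  hence bc: "int p * a0\<^sup>2 + c * \<gamma> = - 1" using p by (simp only: mult_cancel_left) simp
  have "(sqrt_neg p) * x / x = (of_int (int p * a0) * x + of_int (int p * c) * y) / x"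
    using L(3) by simp
  hence s: "sqrt_neg p = of_int (int p * a0) + of_int (int p * c) * \<tau>"
    using L1(2) by (simp add: \<tau>_def add_divide_distrib)
  have "Im (sqrt_neg p) = real_of_int (int p * c) * Im \<tau>" unfolding s by simp
  hence "real_of_int (int p * c) * Im \<tau> > 0"
    using p by (metis Im_sqrt_neg of_nat_0_less_iff real_sqrt_gt_zero)
  hence "c > 0" using p L(2) by (simp add: \<tau>_def zero_less_mult_iff)
  hence "fricke_form p (- a0) (- \<gamma>) c \<tau>"
    using bc s by (auto simp: fricke_form_def algebra_simps)
  hence "\<tau> \<in> fricke_points p" by (auto simp: fricke_points_def)
  moreover have "x \<in> quad_field p - {0}"
    using L1(2) assms(3) zspan2_gens unfolding L by blast
  moreover have "L = (*) x ` zspan2 1 \<tau>" using L1(2) by (simp add: L(1) zspan2_scale \<tau>_def)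
  ultimately show ?thesis using that by blast
qed

section \<open>The multiplier ring of a fixed point\<close>

text \<open>
  \<open>m + n\<tau>\<close> is a multiplier iff \<open>n \<tau>\<^sup>2\<close> lies in \<open>[1, \<tau>]\<close>, and \<open>p c \<tau>\<^sup>2 = 2 p a \<tau> - b\<close>. The
  conditions simplify because \<open>b c = p a\<^sup>2 + 1\<close> makes \<open>a\<close> prime to \<open>c\<close> and \<open>p\<close> prime to \<open>b c\<close>.
\<close>

lemma multiplier_ring_fricke_dvd:
  assumes "prime p" "fricke_form p a b c \<tau>"
  shows "x \<in> multiplier_ring p (zspan2 1 \<tau>) \<longleftrightarrow>
    (\<exists>m n. x = of_int m + of_int n * \<tau> \<and> int p * c dvd 2 * n \<and> int p * c dvd n * b)"
proof -
  have p: "p > 0" using assms by (simp add: prime_gt_0_nat)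
  note Im = fricke_form_Im[OF p assms(2)]
  have c: "c > 0" and bc: "b * c = int p * a\<^sup>2 + 1" using assms(2) by (auto simp: fricke_form_def)
  have pc0: "of_int (int p * c) \<noteq> (0::complex)" using c p by simp
  note quad = fricke_form_sqrt_neg(3)[OF p assms(2)]
  have key: "of_int n * (\<tau> * \<tau>) \<in> zspan2 1 \<tau> \<longleftrightarrow> int p * c dvd 2 * n \<and> int p * c dvd n * b" for n
  proof
    assume "of_int n * (\<tau> * \<tau>) \<in> zspan2 1 \<tau>"
    then obtain r s where rs: "of_int n * (\<tau> * \<tau>) = of_int r + of_int s * \<tau>"
      by (auto simp: zspan2_def)
    have "of_int n * (of_int (int p * c) * (\<tau> * \<tau>)) = of_int (int p * c) * (of_int r + of_int s * \<tau>)"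
      unfolding rs[symmetric] by simp
    hence "of_int (- n * b) + of_int (2 * int p * a * n) * \<tau> =
      of_int (int p * c * r) + of_int (int p * c * s) * \<tau>"
      unfolding quad by (simp add: algebra_simps)
    hence 1: "- n * b = int p * c * r" and "2 * int p * a * n = int p * c * s"
      using zspan2_coeffs_unique[of \<tau>] Im by (metis less_irrefl)+
    hence "int p * (2 * a * n) = int p * (c * s)" by (simp add: algebra_simps)
    hence 2: "2 * a * n = c * s" using p by (simp only: mult_cancel_left) simp
    \<comment> \<open>Both cancellations below use \<open>b c - p a\<^sup>2 = 1\<close> as a Bezout identity.\<close>
    have nb: "int p * c dvd n * b" using 1 by (metis dvd_minus_iff dvd_triv_left mult_minus_left)
    have "n = int p * (- r * c * c - n * a\<^sup>2)" using 1 bc by algebra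
    then obtain n' where n': "n = int p * n'" by blast
    have "2 * n' = c * (2 * n' * b - s * a)" 
    proof -
      have "2 * n' * (b * c) = 2 * n' * (int p * a\<^sup>2 + 1)" using bc by simp
      moreover have "2 * a * (int p * n') = c * s" using 2 n' by simp
      ultimately show ?thesis by algebra
    qed
    hence "2 * n = int p * c * (2 * n' * b - s * a)" unfolding n' by algebra
    thus "int p * c dvd 2 * n \<and> int p * c dvd n * b" using nb by simp
  next
    assume "int p * c dvd 2 * n \<and> int p * c dvd n * b"
    then obtain k r where k: "2 * n = int p * c * k" and r: "n * b = int p * c * r"
      by (elim conjE dvdE)
    have "of_int (int p * c) * (of_int n * (\<tau> * \<tau>)) = of_int n * (of_int (int p * c) * (\<tau> * \<tau>))"
      by (simp only: mult_ac)
    also have "\<dots> = of_int (int p * a) * (of_int (2 * n) * \<tau>) - of_int (n * b)"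
      unfolding quad by (simp add: algebra_simps)
    also have "\<dots> = of_int (int p * c) * (of_int (- r) * 1 + of_int (int p * a * k) * \<tau>)"
      unfolding k r by (simp add: algebra_simps)
    finally have "of_int n * (\<tau> * \<tau>) = of_int (- r) * 1 + of_int (int p * a * k) * \<tau>"
      using pc0 mult_left_cancel by blast
    thus "of_int n * (\<tau> * \<tau>) \<in> zspan2 1 \<tau>" using zspan2I by metis
  qed
  have sq: "x * \<tau> \<in> zspan2 1 \<tau> \<longleftrightarrow> of_int n * (\<tau> * \<tau>) \<in> zspan2 1 \<tau>"
    if x: "x = of_int m + of_int n * \<tau>" for m n
  proof -
    have m: "of_int j * \<tau> \<in> zspan2 1 \<tau>" for j using zspan2_of_int_mult zspan2_gens by blast
    have e: "x * \<tau> = of_int m * \<tau> + of_int n * (\<tau> * \<tau>)"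
      "of_int n * (\<tau> * \<tau>) = of_int (- m) * \<tau> + x * \<tau>" by (simp_all add: x algebra_simps)
    show ?thesis
    proof
      show "x * \<tau> \<in> zspan2 1 \<tau>" if "of_int n * (\<tau> * \<tau>) \<in> zspan2 1 \<tau>"
        unfolding e(1) by (intro zspan2_add m that)
      show "of_int n * (\<tau> * \<tau>) \<in> zspan2 1 \<tau>" if "x * \<tau> \<in> zspan2 1 \<tau>"
        unfolding e(2) by (intro zspan2_add m that)
    qed
  qed
  have stable: "(*) x ` zspan2 1 \<tau> \<subseteq> zspan2 1 \<tau> \<longleftrightarrow> x \<in> zspan2 1 \<tau> \<and> x * \<tau> \<in> zspan2 1 \<tau>"
  proof
    assume "(*) x ` zspan2 1 \<tau> \<subseteq> zspan2 1 \<tau>"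
    hence "x * 1 \<in> zspan2 1 \<tau>" "x * \<tau> \<in> zspan2 1 \<tau>" using zspan2_gens by blast+
    thus "x \<in> zspan2 1 \<tau> \<and> x * \<tau> \<in> zspan2 1 \<tau>" by simp
  qed (simp add: zspan2_scale zspan2_subset)
  have K: "zspan2 1 \<tau> \<subseteq> quad_field p"
    using zspan2_quad_field[OF quad_field_of_int[of 1] fricke_form_quad_field[OF p assms(2)]] by simp
  have "x \<in> multiplier_ring p (zspan2 1 \<tau>) \<longleftrightarrow> x \<in> zspan2 1 \<tau> \<and> x * \<tau> \<in> zspan2 1 \<tau>"
    using K stable by (auto simp: multiplier_ring_def)
  also have "\<dots> \<longleftrightarrow> (\<exists>m n. x = of_int m + of_int n * \<tau> \<and> x * \<tau> \<in> zspan2 1 \<tau>)"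
    by (auto simp: zspan2_def)
  also have "\<dots> \<longleftrightarrow> (\<exists>m n. x = of_int m + of_int n * \<tau> \<and> int p * c dvd 2 * n \<and> int p * c dvd n * b)"
    using sq key by blast
  finally show ?thesis .
qed

text \<open>
  The content of \<open>[p c, -2 p a, b]\<close> divides \<open>2\<close>. For a primitive form the multiplier ring
  is \<open>[1, p c \<tau>]\<close>, of the same discriminant \<open>-4p\<close>; for content \<open>2\<close> it is \<open>[1, p c \<tau> / 2]\<close>, of
  discriminant \<open>-p\<close>.
\<close>

lemma multiplier_ring_primitive:
  assumes "prime p" "fricke_form p a b c \<tau>" "odd b \<or> odd c"
  shows "multiplier_ring p (zspan2 1 \<tau>) = zspan2 1 (sqrt_neg p)"
proof -
  have p: "p > 0" using assms by (simp add: prime_gt_0_nat)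
  have bc: "b * c = int p * a\<^sup>2 + 1" using assms(2) by (auto simp: fricke_form_def)
  have dvd: "int p * c dvd 2 * n \<and> int p * c dvd n * b \<longleftrightarrow> int p * c dvd n" for n
  proof
    assume h: "int p * c dvd 2 * n \<and> int p * c dvd n * b"
    show "int p * c dvd n"
    proof (cases "odd b")
      case True
      then obtain j where "b = 2 * j + 1" by (auto elim: oddE)
      hence "n = n * b - 2 * n * j" by (simp add: algebra_simps)
      thus ?thesis using h by (metis dvd_diff dvd_mult2)
    next
      case False
      have "odd (int p * c)"
        using assms(3) False bc by (metis even_mult_iff even_plus_one_iff)
      hence "coprime (int p * c) 2" by simp
      thus ?thesis using h coprime_dvd_mult_right_iff by blast
    qed
  qed auto
  have e: "of_int m + of_int (int p * c * k) * \<tau> = of_int (m + k * int p * a) + of_int k * sqrt_neg p" for m k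
    by (subst fricke_form_sqrt_neg(1)[OF p assms(2)]) (simp add: algebra_simps)
  show ?thesis
  proof (intro set_eqI iffI)
    fix x
    assume "x \<in> multiplier_ring p (zspan2 1 \<tau>)"
    then obtain m k where "x = of_int m + of_int (int p * c * k) * \<tau>"
      unfolding multiplier_ring_fricke_dvd[OF assms(1,2)] dvd by blast
    thus "x \<in> zspan2 1 (sqrt_neg p)" unfolding e using zspan2I[of _ 1 _ "sqrt_neg p"] by (metis mult_1_right)
  next
    fix x
    assume "x \<in> zspan2 1 (sqrt_neg p)"
    then obtain m k where "x = of_int m + of_int k * sqrt_neg p" by (auto simp: zspan2_def)
    hence "x = of_int (m - k * int p * a) + of_int (int p * c * k) * \<tau>" unfolding e by simp
    thus "x \<in> multiplier_ring p (zspan2 1 \<tau>)"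
      unfolding multiplier_ring_fricke_dvd[OF assms(1,2)] dvd by (metis dvd_triv_left)
  qed
qed

lemma multiplier_ring_imprimitive:
  assumes "prime p" "fricke_form p a b c \<tau>" "even b" "even c"
  shows "multiplier_ring p (zspan2 1 \<tau>) = zspan2 1 ((1 + sqrt_neg p) / 2)"
proof -
  have p: "p > 0" using assms by (simp add: prime_gt_0_nat)
  have bc: "b * c = int p * a\<^sup>2 + 1" using assms(2) by (auto simp: fricke_form_def)
  from assms(4) obtain c2 where c2: "c = 2 * c2" by blast
  have dvd: "int p * c dvd 2 * n \<and> int p * c dvd n * b \<longleftrightarrow> int p * c2 dvd n" for n
  proof -
    have "int p * c dvd 2 * n \<longleftrightarrow> int p * c2 dvd n"
      using dvd_mult_cancel_left[of 2 "int p * c2" n] by (simp add: c2 mult.left_commute)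
    moreover have "int p * c dvd n * b" if "int p * c dvd 2 * n"
    proof -
      from assms(3) obtain b2 where "b = 2 * b2" by blast
      hence "n * b = 2 * n * b2" by simp
      thus ?thesis using that by (simp only: dvd_mult2)
    qed
    ultimately show ?thesis by blast
  qed
  have "odd (int p * a\<^sup>2)" using bc assms(3) by (metis dvd_mult2 even_plus_one_iff)
  hence "odd (int p * a)" by simp
  then obtain j where j: "int p * a = 2 * j + 1" by (rule oddE)
  define u where "u = of_int (int p * c2) * \<tau>"
  have "2 * u = 2 * of_int j + (1 + sqrt_neg p)"
    using fricke_form_sqrt_neg(1)[OF p assms(2)] unfolding j by (simp add: u_def c2 algebra_simps)
  hence "u = of_int j + (1 + sqrt_neg p) / 2" by (simp add: field_simps)
  hence span: "zspan2 1 ((1 + sqrt_neg p) / 2) = zspan2 1 u" by (simp only: zspan2_shift)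
  have "x \<in> multiplier_ring p (zspan2 1 \<tau>) \<longleftrightarrow> x \<in> zspan2 1 u" for x
    unfolding multiplier_ring_fricke_dvd[OF assms(1,2)] dvd
  proof
    assume "\<exists>m n. x = of_int m + of_int n * \<tau> \<and> int p * c2 dvd n"
    then obtain m k where "x = of_int m + of_int (int p * c2 * k) * \<tau>" by blast
    hence "x = of_int m * 1 + of_int k * u" by (simp add: u_def)
    thus "x \<in> zspan2 1 u" using zspan2I by metis
  next
    assume "x \<in> zspan2 1 u"
    then obtain m k where "x = of_int m * 1 + of_int k * u" by (auto simp: zspan2_def)
    hence "x = of_int m + of_int (int p * c2 * k) * \<tau>" by (simp add: u_def)
    thus "\<exists>m n. x = of_int m + of_int n * \<tau> \<and> int p * c2 dvd n" by (metis dvd_triv_left)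
  qed
  thus ?thesis unfolding span by blast
qed

lemma fricke_point_proper_iff:
  assumes "p > 0" "\<tau> \<in> fricke_points p"
  shows "zspan2 1 \<tau> \<in> proper_ideals p R \<longleftrightarrow> multiplier_ring p (zspan2 1 \<tau>) = R"
proof -
  from assms(2) obtain a b c where f: "fricke_form p a b c \<tau>" by (auto simp: fricke_points_def)
  have "zspan2 1 \<tau> \<subseteq> quad_field p"
    using zspan2_quad_field[OF quad_field_of_int[of 1] fricke_form_quad_field[OF assms(1) f]] by simp
  moreover have "\<tau> / 1 \<notin> \<real>"
    using fricke_form_Im[OF assms(1) f] by (simp add: complex_is_Real_iff)
  hence "is_lattice (zspan2 1 \<tau>)" unfolding is_lattice_def
    by (subst zspan2_swap, intro exI[of _ \<tau>] exI[of _ 1]) auto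
  ultimately show ?thesis by (auto simp: proper_ideals_def)
qed

text \<open>If \<open>b\<close> and \<open>c\<close> were both even, then \<open>p a\<^sup>2 + 1 \<equiv> a\<^sup>2 + 1\<close> would vanish modulo \<open>4\<close>.\<close>

lemma fricke_point_proper_mod4_1:
  assumes "prime p" "p mod 4 = 1" "\<tau> \<in> fricke_points p"
  shows "zspan2 1 \<tau> \<in> proper_ideals p (max_order p)"
proof -
  from assms(3) obtain a b c where f: "fricke_form p a b c \<tau>" by (auto simp: fricke_points_def)
  have "odd b \<or> odd c"
  proof (rule ccontr)
    assume "\<not> (odd b \<or> odd c)"
    then obtain b2 c2 where "b = 2 * b2" "c = 2 * c2" by (auto elim!: evenE)
    moreover have bc: "b * c = int p * a\<^sup>2 + 1" using f by (auto simp: fricke_form_def)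
    ultimately have e: "4 * (b2 * c2) = int p * a\<^sup>2 + 1" by simp
    obtain q where "p = 4 * q + 1" using assms(2) by (metis mult_div_mod_eq)
    hence p: "int p = 4 * int q + 1" by simp
    show False
    proof (cases "even a")
      case True
      then obtain h where "a = 2 * h" by blast
      hence "4 * (b2 * c2 - int p * h\<^sup>2) = 1" using e by (simp add: power2_eq_square algebra_simps)
      thus False by presburger
    next
      case False
      then obtain h where "a = 2 * h + 1" by (auto elim: oddE)
      hence "4 * (b2 * c2 - int q * a\<^sup>2 - h * h - h) = 2"
        using e p by (simp add: power2_eq_square algebra_simps)
      thus False by presburger
    qed
  qed
  with assms f show ?thesis
    by (simp add: fricke_point_proper_iff prime_gt_0_nat multiplier_ring_primitive max_order_def beta_def)
qed

lemma order2_mod4_3: "p mod 4 = 3 \<Longrightarrow> order2 p = zspan2 1 (sqrt_neg p)"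
  using zspan2_shift[of 1 "sqrt_neg p"] by (simp add: order2_def beta_def add_divide_distrib distrib_left)

lemma fricke_point_proper_mod4_3:
  assumes "prime p" "p mod 4 = 3" "\<tau> \<in> fricke_points p"
  shows "zspan2 1 \<tau> \<in> proper_ideals p (max_order p) \<or> zspan2 1 \<tau> \<in> proper_ideals p (order2 p)"
proof -
  from assms(3) obtain a b c where f: "fricke_form p a b c \<tau>" by (auto simp: fricke_points_def)
  note R = multiplier_ring_primitive[OF assms(1) f] multiplier_ring_imprimitive[OF assms(1) f]
  show ?thesis using R assms
    by (auto simp: fricke_point_proper_iff prime_gt_0_nat order2_mod4_3 max_order_def beta_def)
qed

lemma max_order_neq_order2:
  assumes "p > 0"
  shows "max_order p \<noteq> order2 p"
proof
  assume "max_order p = order2 p"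
  hence "beta p \<in> order2 p" using zspan2_gens by (auto simp: max_order_def)
  then obtain m n where "beta p = of_int m + of_int n * (2 * beta p)"
    by (auto simp: order2_def zspan2_def)
  hence "of_int 0 + of_int 1 * beta p = of_int m + of_int (2 * n) * beta p"
    by (simp add: mult.assoc mult.left_commute)
  moreover have "Im (beta p) \<noteq> 0" using assms by (simp add: beta_def Im_sqrt_neg)
  ultimately have "1 = 2 * n" using zspan2_coeffs_unique by metis
  thus False by presburger
qed

lemma sqrt_neg_in_orders:
  assumes "odd p"
  shows "sqrt_neg p \<in> max_order p" "p mod 4 = 3 \<Longrightarrow> sqrt_neg p \<in> order2 p"
proof -
  show "p mod 4 = 3 \<Longrightarrow> sqrt_neg p \<in> order2 p" by (simp add: order2_mod4_3 zspan2_gens)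
  have "sqrt_neg p = of_int (- 1) * 1 + of_int 2 * ((1 + sqrt_neg p) / 2)"
    by (simp add: field_simps)
  hence "sqrt_neg p \<in> zspan2 1 ((1 + sqrt_neg p) / 2)" using zspan2I by metis
  thus "sqrt_neg p \<in> max_order p" by (simp add: max_order_def beta_def zspan2_gens)
qed

section \<open>The correspondence\<close>

lemma ideal_class_from_fricke_point:
  assumes "prime p" "sqrt_neg p \<in> R" "C \<in> Cl p R"
  obtains \<tau> where "\<tau> \<in> fricke_points p" "zspan2 1 \<tau> \<in> proper_ideals p R"
    "C = ideal_class p R (zspan2 1 \<tau>)"
proof -
  from assms(3) obtain L where L: "L \<in> proper_ideals p R" "C = ideal_class p R L"
    by (auto simp: Cl_def ideal_class_def elim!: quotientE)
  hence "sqrt_neg p \<in> multiplier_ring p L" using assms(2) by (simp add: proper_ideals_def)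
  hence "(*) (sqrt_neg p) ` L \<subseteq> L" by (simp add: multiplier_ring_def)
  then obtain \<tau> \<mu> where t: "\<tau> \<in> fricke_points p" "\<mu> \<in> quad_field p - {0}" "L = (*) \<mu> ` zspan2 1 \<tau>"
    using stable_lattice_homothetic_fricke_point[OF assms(1)] L(1)
    unfolding proper_ideals_def by (metis (lifting) mem_Collect_eq)
  have "zspan2 1 \<tau> = (*) (inverse \<mu>) ` L" using t by (simp add: image_image flip: mult.assoc)
  hence proper: "zspan2 1 \<tau> \<in> proper_ideals p R"
    using proper_ideals_homothety[OF L(1), of "inverse \<mu>"] t(2) quad_field_inverse by auto
  have "C = ideal_class p R (zspan2 1 \<tau>)"
    using ideal_class_eq_iff[OF proper L(1)] t(2,3) L(2) by blast
  thus ?thesis using t(1) proper that by blast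
qed

text \<open>
  Passes from points to classes: \<open>q\<close> will be the map to \<open>X\<^sub>0(p)\<close> and \<open>h\<close> the map to ideal classes,
  both defined on the same set of points of the upper half-plane.
\<close>

lemma bij_betw_of_common_kernel:
  assumes "q ` F = A" "h ` F = B" "\<And>x y. x \<in> F \<Longrightarrow> y \<in> F \<Longrightarrow> q x = q y \<longleftrightarrow> h x = h y"
  shows "\<exists>f. bij_betw f A B \<and> (\<forall>x \<in> F. f (q x) = h x)"
proof (intro exI conjI ballI)
  define f where "f = h \<circ> inv_into F q"
  show f: "f (q x) = h x" if "x \<in> F" for x
    using that assms(3)[of "inv_into F q (q x)" x]
    by (simp add: f_def inv_into_into f_inv_into_f)
  show "bij_betw f A B"
    unfolding bij_betw_def assms(1,2)[symmetric]
    using assms(3) f by (auto simp: inj_on_def image_image)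
qed

lemma cls0_eq_iff_ideal_class_eq:
  assumes "prime p" "\<tau> \<in> fricke_points p" "\<sigma> \<in> fricke_points p"
    "zspan2 1 \<tau> \<in> proper_ideals p R" "zspan2 1 \<sigma> \<in> proper_ideals p R"
  shows "cls0 p \<tau> = cls0 p \<sigma> \<longleftrightarrow>
    ideal_class p R (zspan2 1 \<tau>) = ideal_class p R (zspan2 1 \<sigma>)"
  unfolding cls0_eq_iff_homothetic[OF assms(1-3)] ideal_class_eq_iff[OF assms(4,5)] ..

lemma ideal_class_in_Cl: "L \<in> proper_ideals p R \<Longrightarrow> ideal_class p R L \<in> Cl p R"
  by (simp add: Cl_def ideal_class_def quotientI)

theorem mainTheorem3:
  fixes p :: nat
  assumes "prime p" and "odd p"
  shows
    "(\<forall>P \<in> ramification_points p. \<exists>\<tau>. Im \<tau> > 0 \<and> P = cls0 p \<tau>) \<and>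
     (p mod 4 = 1 \<longrightarrow>
       (\<exists>f. bij_betw f (ramification_points p) (Cl p (max_order p)) \<and>
         (\<forall>\<tau>. Im \<tau> > 0 \<and> cls0 p \<tau> \<in> ramification_points p \<longrightarrow>
           zspan2 1 \<tau> \<in> proper_ideals p (max_order p) \<and>
           f (cls0 p \<tau>) = ideal_class p (max_order p) (zspan2 1 \<tau>)))) \<and>
     (p mod 4 = 3 \<longrightarrow>
       (\<exists>f. bij_betw f (ramification_points p) (Cl p (max_order p) <+> Cl p (order2 p)) \<and>
         (\<forall>\<tau>. Im \<tau> > 0 \<and> cls0 p \<tau> \<in> ramification_points p \<longrightarrow>
           (zspan2 1 \<tau> \<in> proper_ideals p (max_order p) \<and>
             f (cls0 p \<tau>) = Inl (ideal_class p (max_order p) (zspan2 1 \<tau>))) \<or>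
           (zspan2 1 \<tau> \<in> proper_ideals p (order2 p) \<and>
             f (cls0 p \<tau>) = Inr (ideal_class p (order2 p) (zspan2 1 \<tau>))))))"
proof (intro conjI impI)
  let ?F = "fricke_points p" and ?M = "max_order p" and ?O = "order2 p"
  have p: "p > 0" using assms by (simp add: prime_gt_0_nat)
  have ram: "cls0 p ` ?F = ramification_points p" using ramification_points_eq[OF assms] by simp
  have Im: "Im \<tau> > 0" if "\<tau> \<in> ?F" for \<tau>
    using that fricke_form_Im[OF p] by (auto simp: fricke_points_def)
  show "\<forall>P \<in> ramification_points p. \<exists>\<tau>. Im \<tau> > 0 \<and> P = cls0 p \<tau>"
    using Im by (auto simp flip: ram)
  note ram_iff = cls0_ramification_iff[OF assms]
  {
    assume mod: "p mod 4 = 1"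
    note proper = fricke_point_proper_mod4_1[OF assms(1) mod]
    define h where "h = (\<lambda>\<tau>. ideal_class p ?M (zspan2 1 \<tau>))"
    have im: "h ` ?F = Cl p ?M"
    proof
      show "h ` ?F \<subseteq> Cl p ?M" using proper by (auto simp: h_def intro: ideal_class_in_Cl)
      show "Cl p ?M \<subseteq> h ` ?F"
        using ideal_class_from_fricke_point[OF assms(1) sqrt_neg_in_orders(1)[OF assms(2)]]
        by (auto simp: h_def image_iff)
    qed
    have ker: "cls0 p x = cls0 p y \<longleftrightarrow> h x = h y" if "x \<in> ?F" "y \<in> ?F" for x y
      unfolding h_def by (intro cls0_eq_iff_ideal_class_eq assms(1) that proper)
    obtain f where "bij_betw f (ramification_points p) (Cl p ?M)"
      "\<And>\<tau>. \<tau> \<in> ?F \<Longrightarrow> f (cls0 p \<tau>) = h \<tau>"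
      using bij_betw_of_common_kernel[OF ram im ker] by blast
    thus "\<exists>f. bij_betw f (ramification_points p) (Cl p ?M) \<and>
         (\<forall>\<tau>. Im \<tau> > 0 \<and> cls0 p \<tau> \<in> ramification_points p \<longrightarrow>
           zspan2 1 \<tau> \<in> proper_ideals p ?M \<and>
           f (cls0 p \<tau>) = ideal_class p ?M (zspan2 1 \<tau>))"
      using proper ram_iff by (intro exI[of _ f]) (auto simp: h_def)
  }
  {
    assume mod: "p mod 4 = 3"
    note proper = fricke_point_proper_mod4_3[OF assms(1) mod]
    have excl: "\<not> (L \<in> proper_ideals p ?M \<and> L \<in> proper_ideals p ?O)" for L
      using max_order_neq_order2[OF p] by (auto simp: proper_ideals_def)
    define h where "h = (\<lambda>\<tau>. if zspan2 1 \<tau> \<in> proper_ideals p ?M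
      then Inl (ideal_class p ?M (zspan2 1 \<tau>)) else Inr (ideal_class p ?O (zspan2 1 \<tau>)))"
    have h: "zspan2 1 \<tau> \<in> proper_ideals p ?M \<Longrightarrow> h \<tau> = Inl (ideal_class p ?M (zspan2 1 \<tau>))"
      "zspan2 1 \<tau> \<in> proper_ideals p ?O \<Longrightarrow> h \<tau> = Inr (ideal_class p ?O (zspan2 1 \<tau>))" for \<tau>
      using excl by (auto simp: h_def)
    have im: "h ` ?F = Cl p ?M <+> Cl p ?O"
    proof
      show "h ` ?F \<subseteq> Cl p ?M <+> Cl p ?O"
        using proper h ideal_class_in_Cl by fastforce
      have "Inl C \<in> h ` ?F" if "C \<in> Cl p ?M" for C
        using ideal_class_from_fricke_point[OF assms(1) sqrt_neg_in_orders(1)[OF assms(2)] that] h(1)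
        by (metis image_eqI)
      moreover have "Inr C \<in> h ` ?F" if "C \<in> Cl p ?O" for C
        using ideal_class_from_fricke_point[OF assms(1) sqrt_neg_in_orders(2)[OF assms(2) mod] that] h(2)
        by (metis image_eqI)
      ultimately show "Cl p ?M <+> Cl p ?O \<subseteq> h ` ?F" by auto
    qed
    have ker: "cls0 p x = cls0 p y \<longleftrightarrow> h x = h y" if F: "x \<in> ?F" "y \<in> ?F" for x y
    proof -
      have same: "zspan2 1 y \<in> proper_ideals p R"
        if "cls0 p x = cls0 p y" "zspan2 1 x \<in> proper_ideals p R" for R
        using that cls0_eq_iff_homothetic[OF assms(1) F] proper_ideals_homothety by metis
      show ?thesis
        using proper[OF F(1)] proper[OF F(2)] same[of ?M] same[of ?O] h excl
          cls0_eq_iff_ideal_class_eq[OF assms(1) F, of ?M]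
          cls0_eq_iff_ideal_class_eq[OF assms(1) F, of ?O]
        by (metis Inl_Inr_False sum.inject)
    qed
    obtain f where f: "bij_betw f (ramification_points p) (Cl p ?M <+> Cl p ?O)"
      "\<And>\<tau>. \<tau> \<in> ?F \<Longrightarrow> f (cls0 p \<tau>) = h \<tau>"
      using bij_betw_of_common_kernel[OF ram im ker] by blast
    have "(zspan2 1 \<tau> \<in> proper_ideals p ?M \<and> f (cls0 p \<tau>) = Inl (ideal_class p ?M (zspan2 1 \<tau>))) \<or>
          (zspan2 1 \<tau> \<in> proper_ideals p ?O \<and> f (cls0 p \<tau>) = Inr (ideal_class p ?O (zspan2 1 \<tau>)))"
      if "Im \<tau> > 0" "cls0 p \<tau> \<in> ramification_points p" for \<tau>
    proof -
      have "\<tau> \<in> ?F" using that ram_iff by blast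
      thus ?thesis using proper h f(2) by metis
    qed
    with f(1) show "\<exists>f. bij_betw f (ramification_points p) (Cl p ?M <+> Cl p ?O) \<and>
         (\<forall>\<tau>. Im \<tau> > 0 \<and> cls0 p \<tau> \<in> ramification_points p \<longrightarrow>
           (zspan2 1 \<tau> \<in> proper_ideals p ?M \<and>
             f (cls0 p \<tau>) = Inl (ideal_class p ?M (zspan2 1 \<tau>))) \<or>
           (zspan2 1 \<tau> \<in> proper_ideals p ?O \<and>
             f (cls0 p \<tau>) = Inr (ideal_class p ?O (zspan2 1 \<tau>))))"
      by blast
  }
qed

end
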